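(* Let $\gamma$ be the standard Gaussian measure on $\mathbb{R}^n$ and let $u=(u_t)_{t\ge0}$ be a (gradient flow) solution of the Fokker-Planck equation $$\frac{\partial u_t}{\partial t}=\Delta u_t+\nabla\cdot(u_t\,x),\qquad t>0,\ x\in\mathbb{R}^n,$$ with initial datum $u_0\in P_2(\mathbb{R}^n)$ such that $\int|x|^2\,du_0\le n$. Then for all $t\ge0$, $$W_2^2(u_t,\gamma)\le W_2^2(u_0,\gamma)\,e^{-2t}\,\frac{1-W_2^2(u_0,\gamma)/(4n)}{1-W_2^2(u_0,\gamma)\,e^{-2t}/(4n)}.$$
   Context: $P_2(\mathbb{R}^n)$ is the set of probability measures on $\mathbb{R}^n$ with finite second moment, and $W_2(\mu,\nu)=\inf_\pi(\iint|y-x|^2d\pi(x,y))^{1/2}$ over couplings $\pi$ of $\mu$ and $\nu$. The standard Gaussian $\gamma$ has density $(2\pi)^{-n/2}e^{-|x|^2/2}$. The solution is the gradient flow solution $u\in C([0,+\infty),P_2(\mathbb{R}^n))$, i.e. the gradient flow of the relative entropy $H(\cdot|\gamma)$ on $(P_2(\mathbb{R}^n),W_2)$; it solves the equation in the sense of distributions, and $u_t$ is the law at time $t$ of the solution of $dX_t=\sqrt2\,dB_t-X_t\,dt$ with $X_0$ of law $u_0$ and $(B_t)$ a standard Brownian motion on $\mathbb{R}^n$. *)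

theory Defs
  imports "HOL-Probability.Probability"
begin

section \<open>The Wasserstein space\<close>

definition P2 :: "'a::euclidean_space measure set" where
  "P2 = {\<mu>. prob_space \<mu> \<and> sets \<mu> = sets borel \<and> integrable \<mu> (\<lambda>x. (norm x)\<^sup>2)}"

definition couplings ::
    "'a::euclidean_space measure \<Rightarrow> 'a measure \<Rightarrow> ('a \<times> 'a) measure set" where
  "couplings \<mu> \<nu> = {\<pi>. sets \<pi> = sets borel \<and> distr \<pi> borel fst = \<mu> \<and> distr \<pi> borel snd = \<nu>}"

text \<open>The value is meaningful for arguments in \<^const>\<open>P2\<close>: then the set of couplings is nonempty
  and the cost is integrable with respect to each of them.\<close>

definition W2 :: "'a::euclidean_space measure \<Rightarrow> 'a measure \<Rightarrow> real" where
  "W2 \<mu> \<nu> = (INF \<pi>\<in>couplings \<mu> \<nu>. sqrt (LINT z|\<pi>. (norm (snd z - fst z))\<^sup>2))"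

definition std_gaussian :: "'a::euclidean_space measure" where
  "std_gaussian = density lborel
     (\<lambda>x. ennreal ((2 * pi) powr (- real DIM('a) / 2) * exp (- (norm x)\<^sup>2 / 2)))"

section \<open>Gradient flow of the relative entropy\<close>

text \<open>For a probability measure \<open>\<nu>\<close>, the negative part of the logarithm of the density of \<open>\<mu>\<close> is
  always \<open>\<mu>\<close>-integrable, so that failure of integrability means that the entropy is infinite.\<close>

definition rel_entropy :: "'a measure \<Rightarrow> 'a measure \<Rightarrow> ereal" where
  "rel_entropy \<mu> \<nu> =
     (if absolutely_continuous \<nu> \<mu> \<and> integrable \<mu> (entropy_density (exp 1) \<nu> \<mu>)
      then ereal (KL_divergence (exp 1) \<nu> \<mu>) else \<infinity>)"

text \<open>Gradient flow, in the sense of the evolution variational inequality with parameter \<open>\<kappa>\<close>,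
  of a functional \<open>F\<close> that is bounded below on the metric space \<open>(X, d)\<close>: a curve in
  \<open>C([0,\<infinity>), X)\<close> such that for all \<open>t > 0\<close> and all \<open>v\<close> in the domain of \<open>F\<close>
  \<open>1/2 d\<^sup>+/dt d(u\<^sub>t, v)\<^sup>2 + \<kappa>/2 d(u\<^sub>t, v)\<^sup>2 + F(u\<^sub>t) \<le> F(v)\<close>,
  where \<open>d\<^sup>+/dt\<close> is the upper right Dini derivative.\<close>

definition evi_gradient_flow ::
    "'s set \<Rightarrow> ('s \<Rightarrow> 's \<Rightarrow> real) \<Rightarrow> ('s \<Rightarrow> ereal) \<Rightarrow> real \<Rightarrow> (real \<Rightarrow> 's) \<Rightarrow> bool" where
  "evi_gradient_flow X d F \<kappa> u \<longleftrightarrow>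
     (\<forall>t\<ge>0. u t \<in> X) \<and>
     (\<forall>t\<ge>0. ((\<lambda>s. d (u s) (u t)) \<longlongrightarrow> 0) (at t within {0..})) \<and>
     (\<forall>t>0. F (u t) < \<infinity>) \<and>
     (\<forall>t>0. \<forall>v\<in>X. F v < \<infinity> \<longrightarrow>
        Limsup (at_right 0) (\<lambda>h. ereal (((d (u (t + h)) v)\<^sup>2 - (d (u t) v)\<^sup>2) / (2 * h)))
          + ereal (\<kappa> / 2 * (d (u t) v)\<^sup>2) + F (u t) \<le> F v)"

text \<open>The relative entropy with respect to the standard Gaussian is \<open>1\<close>-convex along the
  geodesics of the Wasserstein space, whence the parameter \<open>1\<close>.\<close>

definition entropy_gradient_flow :: "(real \<Rightarrow> 'a::euclidean_space measure) \<Rightarrow> bool" where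
  "entropy_gradient_flow u \<longleftrightarrow>
     evi_gradient_flow P2 W2 (\<lambda>\<mu>. rel_entropy \<mu> std_gaussian) 1 u"

section \<open>The Fokker-Planck equation in the sense of distributions\<close>

abbreviation dir_deriv :: "'b::real_normed_vector \<Rightarrow> ('b \<Rightarrow> real) \<Rightarrow> 'b \<Rightarrow> real" where
  "dir_deriv v f z \<equiv> frechet_derivative f (at z) v"

primrec C_k :: "nat \<Rightarrow> ('b::real_normed_vector \<Rightarrow> real) \<Rightarrow> bool" where
  "C_k 0 f \<longleftrightarrow> continuous_on UNIV f"
| "C_k (Suc k) f \<longleftrightarrow> (\<forall>z. f differentiable at z) \<and> (\<forall>v. C_k k (dir_deriv v f))"

definition test_functions :: "'b::real_normed_vector set \<Rightarrow> ('b \<Rightarrow> real) set" where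
  "test_functions U = {\<phi>. (\<forall>k. C_k k \<phi>) \<and>
     compact (closure {z. \<phi> z \<noteq> 0}) \<and> closure {z. \<phi> z \<noteq> 0} \<subseteq> U}"

text \<open>The formal adjoint \<open>\<partial>\<^sub>t\<phi> + \<Delta>\<phi> - x \<cdot> \<nabla>\<phi>\<close> of the operator
  \<open>u \<mapsto> - \<partial>\<^sub>tu + \<Delta>u + \<nabla>\<cdot>(u x)\<close>, for \<open>\<phi>\<close> depending on \<open>(t, x)\<close>.\<close>

definition fokker_planck_adjoint ::
    "(real \<times> 'a::euclidean_space \<Rightarrow> real) \<Rightarrow> real \<Rightarrow> 'a \<Rightarrow> real" where
  "fokker_planck_adjoint \<phi> t x =
     dir_deriv (1, 0) \<phi> (t, x)
     + (\<Sum>b\<in>Basis. dir_deriv (0, b) (dir_deriv (0, b) \<phi>) (t, x))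
     - dir_deriv (0, x) \<phi> (t, x)"

definition fokker_planck_solution :: "(real \<Rightarrow> 'a::euclidean_space measure) \<Rightarrow> bool" where
  "fokker_planck_solution u \<longleftrightarrow>
     (\<forall>\<phi>\<in>test_functions ({0<..} \<times> UNIV).
        (LINT t:{0<..}|lborel. (LINT x|u t. fokker_planck_adjoint \<phi> t x)) = 0)"

end

theory Submission
  imports Defs
begin

text \<open>
  Put \<open>q = e\<^sup>-\<^sup>2\<^sup>t\<close>. The law \<open>u\<^sub>t\<close> is that of \<open>\<surd>q X + \<surd>(1-q) Z\<close>, where \<open>X\<close> has law \<open>u\<^sub>0\<close> and \<open>Z\<close> is an
  independent standard Gaussian. Given this, the estimate follows from a single well-chosen coupling.

  The coupling. Let \<open>(X, G)\<close> be a nearly optimal coupling of \<open>u\<^sub>0\<close> and \<open>\<gamma>\<close>, independent of \<open>Z\<close>, and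
  let \<open>c\<^sup>2 + s\<^sup>2 = 1\<close>. Then \<open>cG + sZ\<close> is again standard Gaussian, so
  \<open>W\<^sub>2\<^sup>2(u\<^sub>t, \<gamma>) \<le> E|\<surd>q X + \<surd>(1-q) Z - cG - sZ|\<^sup>2\<close>. The synchronous choice \<open>c = \<surd>q\<close> only gives the
  contraction factor \<open>q\<close>. With \<open>\<rho> = E(X\<sqdot>G) / n\<close> and \<open>m = E|X|\<^sup>2\<close> the right-hand side is
  \<open>qm + (2-q)n - 2n (\<surd>q \<rho> c + \<surd>(1-q) s)\<close>, and its minimum over the unit circle is
  \<open>qm + (2-q)n - 2n \<surd>(1 - q + q\<rho>\<^sup>2)\<close>. Since \<open>\<rho> = (n + m - W\<^sub>2\<^sup>2(u\<^sub>0, \<gamma>)) / 2n\<close> in the limit, this is an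
  explicit function of \<open>q\<close>, \<open>m\<close> and \<open>W\<^sub>2(u\<^sub>0, \<gamma>)\<close>; the condition \<open>m \<le> n\<close> makes it at most the
  asserted bound, by elementary algebra (\<open>gaussian_profile_le\<close>, \<open>W2_gaussian_contraction\<close>).

  The law of \<open>u\<^sub>t\<close>. The function \<open>exp(e\<^sup>2\<^sup>t|\<xi>|\<^sup>2/2) cos(e\<^sup>t \<xi>\<sqdot>x - \<theta>)\<close> is annihilated by the adjoint
  operator \<open>\<partial>\<^sub>t + \<Delta> - x\<sqdot>\<nabla>\<close>. Hence its integral against \<open>u\<^sub>t\<close> should not depend on \<open>t\<close>, which for
  \<open>\<theta> = 0\<close> and \<open>\<theta> = \<pi>/2\<close> determines the characteristic function of \<open>u\<^sub>t\<close>
  (\<open>charfun_fokker_planck_solution\<close>). As this function of \<open>x\<close> has no compact support, it is multiplied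
  by a bump that is stretched to infinity; all error terms tend to \<open>0\<close> and are bounded uniformly
  (\<open>fokker_planck_wave_weak\<close>). The equation gives derivatives in time only in the sense of
  distributions; the gradient flow is a \<open>W\<^sub>2\<close>-continuous curve, thus
  these integrals are continuous in \<open>t\<close>, and a continuous function with vanishing distributional
  derivative is constant (\<open>constant_if_weak_derivative_zero\<close>). Characteristic functions determine
  measures on a Euclidean space (\<open>charfun_unique\<close>), which also identifies the marginals of the
  coupling above.
\<close>

section \<open>Functions of class C^k\<close>

text \<open>The derivative is given as a family \<open>D\<close> indexed by the direction, because the class \<open>C\<^sup>k\<close> is
  defined through directional derivatives; this form allows the rules for products and compositions
  to be proved by induction on \<open>k\<close> with the usual derivative rules.\<close>

lemma C_k_SucI:
  assumes "\<And>z. (f has_derivative (\<lambda>v. D v z)) (at z)" and "\<And>v. C_k k (D v)"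
  shows "C_k (Suc k) f"
proof -
  have "dir_deriv v f = D v" for v
    using fun_cong[OF frechet_derivative_at[OF assms(1)], of v] by (auto simp: fun_eq_iff)
  with assms show ?thesis
    by (auto simp: differentiable_def)
qed

lemma C_k_SucD:
  assumes "C_k (Suc k) f"
  shows "(f has_derivative (\<lambda>v. dir_deriv v f z)) (at z)" "C_k k (dir_deriv v f)"
  using assms by (auto simp: frechet_derivative_works)

lemma C_k_continuous: "C_k k f \<Longrightarrow> continuous_on UNIV f"
  by (cases k) (auto simp: continuous_on_eq_continuous_at intro: differentiable_imp_continuous_within)

lemma C_k_Suc_mono: "C_k (Suc k) f \<Longrightarrow> C_k k f"
proof (induction k arbitrary: f)
  case 0
  then show ?case using C_k_continuous[of "Suc 0" f] by simp
next
  case (Suc k)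
  show ?case
    by (rule C_k_SucI[OF C_k_SucD(1)[OF Suc.prems]])
      (rule Suc.IH[OF C_k_SucD(2)[OF Suc.prems]])
qed

lemma C_k_const: "C_k k (\<lambda>z. c)"
  by (induction k arbitrary: c) auto

lemma C_k_bounded_linear:
  assumes "bounded_linear f"
  shows "C_k k f"
proof (cases k)
  case 0
  then show ?thesis using linear_continuous_on[OF assms] by simp
next
  case (Suc m)
  show ?thesis
    unfolding Suc
    by (rule C_k_SucI[where D = "\<lambda>v z. f v"])
      (auto intro: bounded_linear_imp_has_derivative[OF assms] C_k_const)
qed

lemma C_k_add: "C_k k f \<Longrightarrow> C_k k g \<Longrightarrow> C_k k (\<lambda>z. f z + g z)"
proof (induction k arbitrary: f g)
  case 0
  then show ?case by (simp add: continuous_on_add)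
next
  case (Suc k)
  show ?case
    by (rule C_k_SucI, rule has_derivative_add[OF C_k_SucD(1)[OF Suc.prems(1)] C_k_SucD(1)[OF Suc.prems(2)]])
      (rule Suc.IH; intro C_k_SucD(2) Suc.prems)
qed

lemma C_k_mult: "C_k k f \<Longrightarrow> C_k k g \<Longrightarrow> C_k k (\<lambda>z. f z * g z)"
proof (induction k arbitrary: f g)
  case 0
  then show ?case by (simp add: continuous_on_mult)
next
  case (Suc k)
  show ?case
    by (rule C_k_SucI, rule has_derivative_mult[OF C_k_SucD(1)[OF Suc.prems(1)] C_k_SucD(1)[OF Suc.prems(2)]])
      (rule C_k_add; rule Suc.IH; intro Suc.prems C_k_SucD(2) C_k_Suc_mono)
qed

lemma C_k_sum: "(\<And>i. i \<in> I \<Longrightarrow> C_k k (f i)) \<Longrightarrow> C_k k (\<lambda>z. \<Sum>i\<in>I. f i z)"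
  by (induction I rule: infinite_finite_induct) (auto intro: C_k_add C_k_const)

lemma C_k_diff: "C_k k f \<Longrightarrow> C_k k g \<Longrightarrow> C_k k (\<lambda>z. f z - g z)"
  using C_k_add[of k f "\<lambda>z. (- 1) * g z"] C_k_mult[OF C_k_const, of k g "- 1"] by simp

lemma C_k_compose:
  fixes h :: "real \<Rightarrow> real"
  shows "C_k k h \<Longrightarrow> C_k k g \<Longrightarrow> C_k k (\<lambda>z. h (g z))"
proof (induction k arbitrary: h g)
  case 0
  then show ?case using continuous_on_compose2[of UNIV h UNIV g] by simp
next
  case (Suc k)
  have *: "((\<lambda>z. h (g z)) has_derivative (\<lambda>v. dir_deriv v g z * dir_deriv 1 h (g z))) (at z)" for z
  proof -
    have lin: "linear (frechet_derivative h (at (g z)))"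
      by (rule linear_frechet_derivative) (use Suc.prems in auto)
    have "((\<lambda>z. h (g z)) has_derivative (\<lambda>v. dir_deriv (dir_deriv v g z) h (g z))) (at z)"
      by (rule has_derivative_compose[OF C_k_SucD(1)[OF Suc.prems(2)] C_k_SucD(1)[OF Suc.prems(1)]])
    moreover have "dir_deriv (dir_deriv v g z) h (g z) = dir_deriv v g z * dir_deriv 1 h (g z)" for v
      using linear_cmul[OF lin, of "dir_deriv v g z" 1] by (simp only: real_scaleR_def mult_1_right)
    ultimately show ?thesis
      by (simp only:)
  qed
  show ?case
    by (rule C_k_SucI[OF *])
      (rule C_k_mult[OF C_k_SucD(2)[OF Suc.prems(2)]
          Suc.IH[OF C_k_SucD(2)[OF Suc.prems(1)] C_k_Suc_mono[OF Suc.prems(2)]]])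
qed

lemma C_k_Suc_real:
  fixes h :: "real \<Rightarrow> real"
  assumes "\<And>x. (h has_real_derivative h' x) (at x)" and "C_k k h'"
  shows "C_k (Suc k) h"
  by (rule C_k_SucI[where D = "\<lambda>v x. h' x * v"])
    (use assms in \<open>auto simp: has_field_derivative_def intro!: C_k_mult C_k_const\<close>)

text \<open>A set of functions that is closed under differentiation consists of smooth functions. This avoids
  formulas for the higher derivatives of the functions concerned.\<close>

lemma C_k_family:
  fixes h :: "real \<Rightarrow> real"
  assumes "\<And>h. h \<in> S \<Longrightarrow> \<exists>h'\<in>S. \<forall>x. (h has_real_derivative h' x) (at x)" and "h \<in> S"
  shows "C_k k h"
  using \<open>h \<in> S\<close>
proof (induction k arbitrary: h)
  case 0
  then show ?case
    using assms(1)[OF 0] by (metis C_k.simps(1) DERIV_isCont continuous_at_imp_continuous_on)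
next
  case (Suc k)
  then show ?case
    using assms(1)[OF Suc.prems] C_k_Suc_real by blast
qed

lemma C_k_exp: "C_k k (exp :: real \<Rightarrow> real)"
  by (rule C_k_family[where S = "{exp}"]) (auto intro: DERIV_exp)

lemma C_k_cos: "C_k k (cos :: real \<Rightarrow> real)"
proof (rule C_k_family)
  let ?S = "{cos, \<lambda>x. - sin x, \<lambda>x. - cos x, sin} :: (real \<Rightarrow> real) set"
  have "(cos has_real_derivative - sin x) (at x)" "((\<lambda>x. - sin x) has_real_derivative - cos x) (at x)"
    "((\<lambda>x. - cos x) has_real_derivative sin x) (at x)" "(sin has_real_derivative cos x) (at x)" for x :: real
    by (auto intro!: derivative_eq_intros)
  then show "\<exists>h'\<in>?S. \<forall>x. (h has_real_derivative h' x) (at x)" if "h \<in> ?S" for h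
    using that by auto
qed simp

section \<open>A smooth bump and a smooth step\<close>

text \<open>For \<open>p = 1\<close> this is the standard flat function \<open>e\<^sup>-\<^sup>1\<^sup>/\<^sup>x\<close>; the polynomial factor makes the family
  closed under differentiation.\<close>

definition flat_exp :: "real poly \<Rightarrow> real \<Rightarrow> real" where
  "flat_exp p x = (if x > 0 then poly p (1 / x) * exp (- (1 / x)) else 0)"

lemma poly_times_exp_tendsto_0:
  fixes p :: "real poly"
  shows "((\<lambda>y. poly p y * exp (- y)) \<longlongrightarrow> 0) at_top"
proof -
  have "((\<lambda>y. \<Sum>i\<le>degree p. coeff p i * (y ^ i / exp y)) \<longlongrightarrow> (\<Sum>i\<le>degree p. coeff p i * 0)) at_top"
    by (intro tendsto_intros tendsto_power_div_exp_0)
  then show ?thesis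
    by (simp add: poly_altdef sum_distrib_right exp_minus divide_inverse mult.assoc)
qed

lemma flat_tendsto_0: "(flat_exp p \<longlongrightarrow> 0) (at 0)"
proof -
  have "((\<lambda>x. poly p (inverse x) * exp (- (inverse x))) \<longlongrightarrow> 0) (at_right 0)"
    by (rule filterlim_compose[OF poly_times_exp_tendsto_0 filterlim_inverse_at_top_right])
  then have "(flat_exp p \<longlongrightarrow> 0) (at_right 0)"
    by (rule Lim_transform_eventually)
      (auto simp: flat_exp_def eventually_at_filter inverse_eq_divide)
  moreover have "(flat_exp p \<longlongrightarrow> 0) (at_left 0)"
    by (rule Lim_transform_eventually[OF tendsto_const])
      (auto simp: flat_exp_def eventually_at_filter)
  ultimately show ?thesis
    by (simp add: filterlim_split_at)
qed

text \<open>At \<open>0\<close> the difference quotient of the function for \<open>p\<close> is the function for the polynomial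
  \<open>X p\<close>, which tends to \<open>0\<close> there because exponentials beat powers.\<close>

lemma flat_has_derivative:
  "(flat_exp p has_real_derivative flat_exp ([:0, 0, 1:] * (p - pderiv p)) x) (at x)"
proof (cases "x = 0")
  case True
  have "((\<lambda>h. flat_exp (pCons 0 p) h) \<longlongrightarrow> 0) (at 0)"
    by (rule flat_tendsto_0)
  moreover have "flat_exp (pCons 0 p) = (\<lambda>h. (flat_exp p (0 + h) - flat_exp p 0) / h)"
    by (auto simp: flat_exp_def fun_eq_iff)
  ultimately show ?thesis
    unfolding True DERIV_def by (simp add: flat_exp_def)
next
  case False
  consider "x > 0" | "x < 0" using False by linarith
  then show ?thesis
  proof cases
    case 1
    have "((\<lambda>x. poly p (1 / x) * exp (- (1 / x))) has_real_derivative
        flat_exp ([:0, 0, 1:] * (p - pderiv p)) x) (at x)"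
      using 1 by (auto intro!: derivative_eq_intros DERIV_chain2[OF poly_DERIV]
        simp: flat_exp_def field_simps power2_eq_square)
    then show ?thesis
      by (rule has_field_derivative_transform_within_open[where S = "{0<..}"])
        (use 1 in \<open>auto simp: flat_exp_def\<close>)
  next
    case 2
    have "((\<lambda>x. 0) has_real_derivative flat_exp ([:0, 0, 1:] * (p - pderiv p)) x) (at x)"
      using 2 by (auto simp: flat_exp_def)
    then show ?thesis
      by (rule has_field_derivative_transform_within_open[where S = "{..<0}"])
        (use 2 in \<open>auto simp: flat_exp_def\<close>)
  qed
qed

lemma C_k_flat: "C_k k (flat_exp p)"
  by (rule C_k_family[where S = "range flat_exp"]) (auto intro: flat_has_derivative)

lemma flat_bounded_above:
  obtains C where "C \<ge> 0" "\<And>x. x \<le> 1 \<Longrightarrow> \<bar>flat_exp p x\<bar> \<le> C"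
proof -
  have "bounded (flat_exp p ` {0..1})"
    by (intro compact_imp_bounded compact_continuous_image
      continuous_on_subset[OF C_k_continuous[OF C_k_flat]]) auto
  then obtain C where C: "\<And>x. x \<in> {0..1} \<Longrightarrow> \<bar>flat_exp p x\<bar> \<le> C"
    unfolding bounded_iff by (metis imageI real_norm_def)
  show ?thesis
  proof (rule that[of C])
    show "C \<ge> 0" using C[of 0] by simp
    fix x :: real assume "x \<le> 1"
    then show "\<bar>flat_exp p x\<bar> \<le> C"
      using C[of x] \<open>C \<ge> 0\<close> by (cases "x \<ge> 0") (auto simp: flat_exp_def)
  qed
qed

text \<open>The bump is \<open>e\<^sup>-\<^sup>1\<^sup>/\<^sup>x e\<^sup>-\<^sup>1\<^sup>/\<^sup>(\<^sup>1\<^sup>-\<^sup>x\<^sup>)\<close>, and the step is an antiderivative of it. Steps are needed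
  besides bumps because the difference of two translated steps is a compactly supported function
  whose derivative is a difference of two translated bumps.\<close>

lemma smooth_step_exists:
  obtains \<rho> \<Theta> :: "real \<Rightarrow> real"
  where "\<And>k. C_k k \<rho>" "\<And>k. C_k k \<Theta>" "\<And>x. (\<Theta> has_real_derivative \<rho> x) (at x)"
    "\<And>x. x \<le> 0 \<Longrightarrow> \<Theta> x = \<Theta> 0" "\<And>x. x \<ge> 1 \<Longrightarrow> \<Theta> x = \<Theta> 1"
    "\<And>x. x \<notin> {0<..<1} \<Longrightarrow> \<rho> x = 0" "\<And>x. x \<in> {0<..<1} \<Longrightarrow> \<rho> x > 0" "\<And>x. \<rho> x \<ge> 0"
proof -
  define \<rho> where "\<rho> x = flat_exp 1 x * flat_exp 1 (1 - x)" for x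
  have \<rho>: "C_k k \<rho>" for k
    unfolding \<rho>_def
    by (intro C_k_mult C_k_flat C_k_compose[OF C_k_flat] C_k_diff C_k_const
      C_k_bounded_linear bounded_linear_ident)
  have "isCont \<rho> x" for x
    using C_k_continuous[OF \<rho>] by (simp add: continuous_on_eq_continuous_at)
  then obtain \<Theta> where "\<And>x. (\<Theta> has_vector_derivative \<rho> x) (at x)"
    using einterval_antiderivative[of "-\<infinity>" \<infinity> \<rho>] by auto
  then have \<Theta>: "(\<Theta> has_real_derivative \<rho> x) (at x)" for x
    by (simp add: has_real_derivative_iff_has_vector_derivative)
  have zero: "\<rho> x = 0" if "x \<notin> {0<..<1}" for x
    using that by (auto simp: \<rho>_def flat_exp_def)
  have const: "\<Theta> x = \<Theta> y" if "x < y" "\<And>z. x < z \<Longrightarrow> z < y \<Longrightarrow> z \<notin> {0<..<1}" for x y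
    using DERIV_isconst_end[of x y \<Theta>] that \<Theta> zero
    by (metis DERIV_isCont continuous_at_imp_continuous_on)
  have "\<Theta> x = \<Theta> 0" if "x \<le> 0" for x
    using const[of x 0] that by (cases "x = 0") auto
  moreover have "\<Theta> x = \<Theta> 1" if "x \<ge> 1" for x
    using const[of 1 x] that by (cases "x = 1") auto
  moreover have "\<rho> x > 0" if "x \<in> {0<..<1}" for x
    using that by (auto simp: \<rho>_def flat_exp_def)
  moreover have "\<rho> x \<ge> 0" for x
    by (auto simp: \<rho>_def flat_exp_def)
  moreover have "C_k k \<Theta>" for k
    using C_k_Suc_mono[OF C_k_Suc_real[OF \<Theta> \<rho>]] .
  ultimately show ?thesis
    using \<rho> \<Theta> zero by (intro that[of \<rho> \<Theta>])
qed

text \<open>A cutoff that depends on \<open>1 - l|x|\<^sup>2\<close> is supported in a ball and tends to a nonzero constant as \<open>l\<close>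
  tends to \<open>0\<close>, hence a flat function serves as a cutoff. The bounds are asked for on the half-line \<open>r \<le> 1\<close>, which contains all values of \<open>1 - l|x|\<^sup>2\<close>.\<close>

lemma bump_exists:
  obtains B B' B'' :: "real \<Rightarrow> real" and C :: real
  where "\<And>k. C_k k B" "\<And>k. C_k k B'" "\<And>k. C_k k B''"
    "\<And>r. (B has_real_derivative B' r) (at r)" "\<And>r. (B' has_real_derivative B'' r) (at r)"
    "\<And>r. r \<le> 0 \<Longrightarrow> B r = 0 \<and> B' r = 0 \<and> B'' r = 0"
    "\<And>r. r \<le> 1 \<Longrightarrow> \<bar>B r\<bar> \<le> C \<and> \<bar>B' r\<bar> \<le> C \<and> \<bar>B'' r\<bar> \<le> C" "B 1 \<noteq> 0"
proof -
  define p :: "real poly" where "p = [:0, 0, 1:] * (1 - pderiv 1)"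
  define p' where "p' = [:0, 0, 1:] * (p - pderiv p)"
  obtain C0 where C0: "\<And>r. r \<le> 1 \<Longrightarrow> \<bar>flat_exp 1 r\<bar> \<le> C0" using flat_bounded_above by metis
  obtain C1 where C1: "\<And>r. r \<le> 1 \<Longrightarrow> \<bar>flat_exp p r\<bar> \<le> C1" using flat_bounded_above by metis
  obtain C2 where C2: "\<And>r. r \<le> 1 \<Longrightarrow> \<bar>flat_exp p' r\<bar> \<le> C2" using flat_bounded_above by metis
  show ?thesis
  proof (rule that[of "flat_exp 1" "flat_exp p" "flat_exp p'" "max C0 (max C1 C2)"])
    show "(flat_exp 1 has_real_derivative flat_exp p r) (at r)" for r
      unfolding p_def by (rule flat_has_derivative)
    show "(flat_exp p has_real_derivative flat_exp p' r) (at r)" for r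
      unfolding p'_def by (rule flat_has_derivative)
    show "\<bar>flat_exp 1 r\<bar> \<le> max C0 (max C1 C2) \<and> \<bar>flat_exp p r\<bar> \<le> max C0 (max C1 C2) \<and>
      \<bar>flat_exp p' r\<bar> \<le> max C0 (max C1 C2)" if "r \<le> 1" for r
      using C0[OF that] C1[OF that] C2[OF that] by auto
  qed (auto simp: flat_exp_def C_k_flat)
qed

section \<open>Functions with vanishing distributional derivative\<close>

lemma integrable_continuous_compact_support:
  fixes f :: "real \<Rightarrow> real"
  assumes "continuous_on UNIV f" and "\<And>x. x \<notin> {a..b} \<Longrightarrow> f x = 0"
  shows "integrable lborel f"
proof -
  have "integrable lborel (\<lambda>x. indicator {a..b} x *\<^sub>R f x)"
    using assms(1) by (intro borel_integrable_compact continuous_on_subset[OF assms(1)]) auto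
  also have "(\<lambda>x. indicator {a..b} x *\<^sub>R f x) = f"
    using assms(2) by (auto simp: fun_eq_iff indicator_def)
  finally show ?thesis .
qed

text \<open>Test with a smooth step at \<open>a\<close> minus the same step at \<open>b\<close>, both of width \<open>1/k\<close>: weighted means of
  \<open>g\<close> over windows of that width to the right of \<open>a\<close> and of \<open>b\<close> agree. As the width tends to \<open>0\<close>, the
  means tend to \<open>g a\<close> and \<open>g b\<close> up to the same factor, the integral of the bump. The value at \<open>0\<close> is
  reached by continuity.\<close>

lemma constant_if_weak_derivative_zero:
  fixes g :: "real \<Rightarrow> real"
  assumes g: "continuous_on {0..} g"
    and weak: "\<And>\<kappa> \<kappa>' a b. 0 < a \<Longrightarrow> (\<And>k. C_k k \<kappa>) \<Longrightarrow> (\<And>k. C_k k \<kappa>') \<Longrightarrow>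
      (\<And>t. (\<kappa> has_real_derivative \<kappa>' t) (at t)) \<Longrightarrow>
      (\<And>t. t \<notin> {a..b} \<Longrightarrow> \<kappa> t = 0) \<Longrightarrow> (\<And>t. t \<notin> {a..b} \<Longrightarrow> \<kappa>' t = 0) \<Longrightarrow>
      (LINT t:{0<..}|lborel. \<kappa>' t * g t) = 0"
    and "t \<ge> 0"
  shows "g t = g 0"
proof -
  obtain \<rho> \<Theta> :: "real \<Rightarrow> real"
    where \<rho>: "\<And>k. C_k k \<rho>" and \<Theta>: "\<And>k. C_k k \<Theta>" "\<And>x. (\<Theta> has_real_derivative \<rho> x) (at x)"
    and \<Theta>_const: "\<And>x. x \<le> 0 \<Longrightarrow> \<Theta> x = \<Theta> 0" "\<And>x. x \<ge> 1 \<Longrightarrow> \<Theta> x = \<Theta> 1"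
    and \<rho>_zero: "\<And>x. x \<notin> {0<..<1} \<Longrightarrow> \<rho> x = 0" and \<rho>_pos: "\<And>x. x \<in> {0<..<1} \<Longrightarrow> \<rho> x > 0"
    and \<rho>_nonneg: "\<And>x. \<rho> x \<ge> 0"
    using smooth_step_exists by metis
  have \<rho>_cont: "continuous_on UNIV \<rho>"
    by (rule C_k_continuous[OF \<rho>[of 0]])
  \<comment> \<open>the extension by the value at \<open>0\<close> makes the integrand continuous on the whole line\<close>
  define G where "G t = g (max t 0)" for t
  have G_cont: "continuous_on UNIV G"
    unfolding G_def by (rule continuous_on_compose2[OF g]) (auto intro: continuous_intros)
  have \<rho>_int: "integrable lborel \<rho>"
    by (rule integrable_continuous_compact_support[OF \<rho>_cont, of 0 1], rule \<rho>_zero) auto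
  have \<rho>_integral: "(LINT s|lborel. \<rho> s) \<noteq> 0"
  proof -
    have pos: "\<Theta> 0 < \<Theta> 1"
    proof (rule DERIV_pos_imp_increasing_open[of 0 1 \<Theta>])
      show "\<exists>y. (\<Theta> has_real_derivative y) (at x) \<and> y > 0" if "0 < x" "x < 1" for x
        using \<Theta>(2)[of x] \<rho>_pos[of x] that by auto
      show "continuous_on {0..1} \<Theta>"
        by (rule continuous_on_subset[OF C_k_continuous[OF \<Theta>(1)[of 0]]]) simp
    qed simp
    have "(LINT s|lborel. \<rho> s) = (LINT s|lborel. \<rho> s * indicator {0..1} s)"
      by (intro Bochner_Integration.integral_cong refl) (auto simp: indicator_def intro!: \<rho>_zero)
    also have "\<dots> = \<Theta> 1 - \<Theta> 0"
      using \<Theta>(2) \<rho>_cont by (intro integral_FTC_Icc_real) (auto simp: continuous_on_eq_continuous_at)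
    finally show ?thesis using pos by simp
  qed
  define J where "J a k = (LINT s|lborel. \<rho> s * G (a + (1 / real (Suc k)) * s))" for a k
  have J_lim: "J a \<longlonglongrightarrow> (LINT s|lborel. \<rho> s) * G a" for a
  proof -
    have "bounded (G ` {a..a + 1})"
      by (intro compact_imp_bounded compact_continuous_image continuous_on_subset[OF G_cont]) auto
    then obtain M where M: "\<And>x. x \<in> {a..a + 1} \<Longrightarrow> \<bar>G x\<bar> \<le> M"
      unfolding bounded_iff by (metis imageI real_norm_def)
    have "J a \<longlonglongrightarrow> (LINT s|lborel. \<rho> s * G a)"
      unfolding J_def
    proof (rule integral_dominated_convergence[where w = "\<lambda>s. \<rho> s * M"])
      show "(\<lambda>s. \<rho> s * G a) \<in> borel_measurable lborel"
        using borel_measurable_integrable[OF \<rho>_int] by measurable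
      show "(\<lambda>s. \<rho> s * G (a + (1 / real (Suc k)) * s)) \<in> borel_measurable lborel" for k
        using \<rho>_cont
        by (simp, intro borel_measurable_continuous_onI continuous_intros continuous_on_compose2[OF G_cont]) auto
      show "integrable lborel (\<lambda>s. \<rho> s * M)" using \<rho>_int by simp
      show "AE s in lborel. (\<lambda>k. \<rho> s * G (a + (1 / real (Suc k)) * s)) \<longlonglongrightarrow> \<rho> s * G a"
      proof (intro AE_I2 tendsto_mult tendsto_const)
        fix s :: real
        have "(\<lambda>k. a + (1 / real (Suc k)) * s) \<longlonglongrightarrow> a + 0 * s"
          by (intro tendsto_intros LIMSEQ_Suc[OF lim_1_over_n])
        then show "(\<lambda>k. G (a + (1 / real (Suc k)) * s)) \<longlonglongrightarrow> G a"
          using continuous_on_tendsto_compose[OF G_cont, of "\<lambda>k. a + (1 / real (Suc k)) * s" "a + 0 * s"]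
          by simp
      qed
      show "AE s in lborel. norm (\<rho> s * G (a + (1 / real (Suc k)) * s)) \<le> \<rho> s * M" for k
      proof (intro AE_I2)
        fix s :: real
        show "norm (\<rho> s * G (a + (1 / real (Suc k)) * s)) \<le> \<rho> s * M"
        proof (cases "s \<in> {0<..<1}")
          case True
          then have "(1 / real (Suc k)) * s \<le> 1 * 1" by (intro mult_mono) auto
          then have "a + (1 / real (Suc k)) * s \<in> {a..a + 1}" using True by auto
          then show ?thesis
            using M \<rho>_nonneg[of s] by (simp add: abs_mult mult_left_mono)
        qed (simp add: \<rho>_zero)
      qed
    qed
    then show ?thesis by simp
  qed
  have subst: "(LINT t|lborel. \<rho> ((t - a) * real (Suc k)) * real (Suc k) * G t) = J a k" for a k
  proof -
    define r where "r = real (Suc k)"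
    have r: "r > 0" by (simp add: r_def)
    have "(LINT t|lborel. \<rho> ((t - a) * r) * r * G t)
        = \<bar>1 / r\<bar> *\<^sub>R (LINT s|lborel. \<rho> ((a + (1 / r) * s - a) * r) * r * G (a + (1 / r) * s))"
      using r by (intro lborel_integral_real_affine) simp
    also have "\<dots> = (LINT s|lborel. \<bar>1 / r\<bar> * (\<rho> ((a + (1 / r) * s - a) * r) * r * G (a + (1 / r) * s)))"
      by (simp only: integral_mult_right_zero real_scaleR_def)
    also have "\<dots> = (LINT s|lborel. \<rho> s * G (a + (1 / r) * s))"
      using r by (intro Bochner_Integration.integral_cong refl) simp
    finally show ?thesis
      unfolding J_def r_def .
  qed
  have int: "integrable lborel (\<lambda>t. \<rho> ((t - a) * real (Suc k)) * real (Suc k) * G t)" for a k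
  proof (rule integrable_continuous_compact_support)
    show "continuous_on UNIV (\<lambda>t. \<rho> ((t - a) * real (Suc k)) * real (Suc k) * G t)"
      by (intro continuous_intros G_cont continuous_on_compose2[OF \<rho>_cont]) auto
    show "\<rho> ((t - a) * real (Suc k)) * real (Suc k) * G t = 0" if "t \<notin> {a..a + 1}" for t
    proof -
      have "(t - a) * real (Suc k) \<notin> {0<..<1}"
      proof
        assume *: "(t - a) * real (Suc k) \<in> {0<..<1}"
        then have pos: "t - a > 0" by (simp add: zero_less_mult_iff)
        then have "(t - a) * 1 \<le> (t - a) * real (Suc k)"
          by (intro mult_left_mono) auto
        with * have "t - a < 1" by (simp del: of_nat_Suc)
        then show False using that pos by simp
      qed
      then show ?thesis by (simp add: \<rho>_zero)
    qed
  qed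
  have J_eq: "J a k = J b k" if "0 < a" "0 < b" for a b k
  proof -
    define r where "r = real (Suc k)"
    have r: "r \<ge> 1" by (simp add: r_def)
    \<comment> \<open>the test function and its derivative, a difference of two rescaled bumps\<close>
    define \<kappa> where "\<kappa> t = \<Theta> ((t - a) * r) - \<Theta> ((t - b) * r)" for t
    define \<kappa>' where "\<kappa>' t = \<rho> ((t - a) * r) * r - \<rho> ((t - b) * r) * r" for t
    have aff: "C_k j (\<lambda>t. (t - c) * r)" for j c
      by (intro C_k_mult C_k_diff C_k_const C_k_bounded_linear bounded_linear_ident)
    have C: "C_k j \<kappa>" "C_k j \<kappa>'" for j
      unfolding \<kappa>_def \<kappa>'_def
      by (intro C_k_diff C_k_mult C_k_const C_k_compose[OF \<Theta>(1) aff] C_k_compose[OF \<rho> aff])+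
    have aff_deriv: "((\<lambda>t. (t - c) * r) has_real_derivative r) (at t)" for c t
      by (auto intro!: derivative_eq_intros)
    have deriv: "(\<kappa> has_real_derivative \<kappa>' t) (at t)" for t
      unfolding \<kappa>_def \<kappa>'_def
      by (intro DERIV_diff DERIV_chain2[OF \<Theta>(2) aff_deriv])
    have out: "t \<le> a \<and> t \<le> b \<or> t \<ge> a + 1 \<and> t \<ge> b + 1" if "t \<notin> {min a b..max a b + 1}" for t
      using that by auto
    have low: "(t - c) * r \<le> 0" if "t \<le> c" for t c
      using that r by (simp add: mult_le_0_iff)
    have high: "1 \<le> (t - c) * r" if "t \<ge> c + 1" for t c
      using mult_mono[of 1 "t - c" 1 r] that r by simp
    have zero: "\<kappa> t = 0" "\<kappa>' t = 0" if outside: "t \<notin> {min a b..max a b + 1}" for t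
    proof -
      consider "t \<le> a" "t \<le> b" | "t \<ge> a + 1" "t \<ge> b + 1" using out[OF outside] by blast
      then have "\<Theta> ((t - a) * r) = \<Theta> ((t - b) * r) \<and> \<rho> ((t - a) * r) = 0 \<and> \<rho> ((t - b) * r) = 0"
      proof cases
        case 1
        then show "\<Theta> ((t - a) * r) = \<Theta> ((t - b) * r) \<and> \<rho> ((t - a) * r) = 0 \<and> \<rho> ((t - b) * r) = 0"
          using \<Theta>_const(1)[OF low] \<rho>_zero low by (metis greaterThanLessThan_iff not_le)
      next
        case 2
        then show "\<Theta> ((t - a) * r) = \<Theta> ((t - b) * r) \<and> \<rho> ((t - a) * r) = 0 \<and> \<rho> ((t - b) * r) = 0"
          using \<Theta>_const(2)[OF high] \<rho>_zero high by (metis greaterThanLessThan_iff not_le)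
      qed
      then show "\<kappa> t = 0" "\<kappa>' t = 0"
        by (simp_all add: \<kappa>_def \<kappa>'_def)
    qed
    have "(LINT t:{0<..}|lborel. \<kappa>' t * g t) = 0"
      by (rule weak[OF _ C deriv zero]) (use that in auto)
    moreover have "indicator {0<..} t *\<^sub>R (\<kappa>' t * g t)
        = \<rho> ((t - a) * r) * r * G t - \<rho> ((t - b) * r) * r * G t" for t
    proof (cases "t > 0")
      case True
      then show ?thesis by (simp add: \<kappa>'_def G_def left_diff_distrib)
    next
      case False
      then show ?thesis using low[of t a] low[of t b] that by (simp add: \<rho>_zero)
    qed
    ultimately have "(LINT t|lborel. \<rho> ((t - a) * r) * r * G t - \<rho> ((t - b) * r) * r * G t) = 0"
      by (simp add: set_lebesgue_integral_def)
    then show ?thesis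
      unfolding r_def using int by (simp add: subst del: of_nat_Suc)
  qed
  have G_eq: "G a = G b" if "0 < a" "0 < b" for a b
  proof -
    have "J a = J b" using J_eq[OF that] by auto
    then have "(LINT s|lborel. \<rho> s) * G a = (LINT s|lborel. \<rho> s) * G b"
      using LIMSEQ_unique[OF J_lim[of a]] J_lim[of b] by simp
    then show ?thesis
      using \<rho>_integral by simp
  qed
  have "G 0 = G 1"
  proof -
    have "(\<lambda>k. G (1 / real (Suc k))) \<longlonglongrightarrow> G 0"
      by (rule continuous_on_tendsto_compose[OF G_cont LIMSEQ_Suc[OF lim_1_over_n]]) auto
    moreover have "(\<lambda>k. G (1 / real (Suc k))) = (\<lambda>k. G 1)"
      by (intro ext G_eq) auto
    ultimately show ?thesis
      using LIMSEQ_unique[OF _ tendsto_const] by metis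
  qed
  moreover have "G t = G 1" if "t \<noteq> 0"
    using G_eq[of t 1] that \<open>t \<ge> 0\<close> by simp
  ultimately show ?thesis
    using \<open>t \<ge> 0\<close> by (cases "t = 0") (auto simp: G_def)
qed

section \<open>The standard Gaussian measure\<close>

lemma norm_power2_Basis: "(norm x)\<^sup>2 = (\<Sum>b\<in>Basis. (x \<bullet> b)\<^sup>2)" for x :: "'a::euclidean_space"
  unfolding power2_norm_eq_inner by (subst euclidean_inner) (simp add: power2_eq_square)

text \<open>The Gaussian density is a product over the coordinates, so that all its integrals below reduce to
  one-dimensional ones.\<close>

lemma std_gaussian_density_prod:
  fixes x :: "'a::euclidean_space"
  shows "(2 * pi) powr (- real DIM('a) / 2) * exp (- (norm x)\<^sup>2 / 2)
    = (\<Prod>b\<in>Basis. std_normal_density (x \<bullet> b))"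
proof -
  have "(2 * pi) powr (- real DIM('a) / 2) = (1 / sqrt (2 * pi)) ^ DIM('a)"
  proof -
    have "(2 * pi) powr (- real DIM('a) / 2) = ((2 * pi) powr (- (1 / 2))) powr real DIM('a)"
      by (simp add: powr_powr)
    also have "\<dots> = (1 / sqrt (2 * pi)) ^ DIM('a)"
      by (subst powr_realpow) (simp_all add: powr_minus powr_half_sqrt inverse_eq_divide)
    finally show ?thesis .
  qed
  moreover have "exp (- (norm x)\<^sup>2 / 2) = (\<Prod>b\<in>Basis. exp (- (x \<bullet> b)\<^sup>2 / 2))"
    by (simp add: norm_power2_Basis exp_sum[symmetric] sum_negf[symmetric] sum_divide_distrib)
  ultimately show ?thesis
    by (simp add: std_normal_density_def prod_dividef power_divide)
qed

lemma std_gaussian_eq_density_prod: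
  "std_gaussian = density lborel (\<lambda>x. ennreal (\<Prod>b\<in>Basis. std_normal_density (x \<bullet> b)))"
  unfolding std_gaussian_def std_gaussian_density_prod ..

lemma
  fixes f :: "'a::euclidean_space \<Rightarrow> real \<Rightarrow> 'b::{real_normed_field,banach,second_countable_topology}"
  assumes "\<And>b. b \<in> Basis \<Longrightarrow> integrable std_normal_distribution (f b)"
  shows integrable_std_gaussian_prod:
      "integrable std_gaussian (\<lambda>x. \<Prod>b\<in>Basis. f b (x \<bullet> b))" (is ?I)
    and integral_std_gaussian_prod:
      "(LINT x|std_gaussian. (\<Prod>b\<in>Basis. f b (x \<bullet> b)))
        = (\<Prod>b\<in>Basis. LINT y|std_normal_distribution. f b y)" (is ?E)
proof -
  interpret product_sigma_finite "\<lambda>_::'a. lborel :: real measure"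
    by standard
  define g where "g b y = std_normal_density y *\<^sub>R f b y" for b y
  have f_meas [measurable]: "f b \<in> borel_measurable borel" if "b \<in> Basis" for b
    using borel_measurable_integrable[OF assms[OF that]] by simp
  have g_int: "integrable lborel (g b)" if "b \<in> Basis" for b
    using assms[OF that] f_meas[OF that] unfolding g_def by (simp add: integrable_density)
  have g_meas [measurable]: "g b \<in> borel_measurable borel" if "b \<in> Basis" for b
    using borel_measurable_integrable[OF g_int[OF that]] by simp
  have dens: "(\<Prod>b\<in>Basis. std_normal_density (x \<bullet> b)) *\<^sub>R (\<Prod>b\<in>Basis. f b (x \<bullet> b))
      = (\<Prod>b\<in>Basis. g b (x \<bullet> b))" for x :: 'a
    unfolding g_def by (simp add: scaleR_conv_of_real prod.distrib)
  have T [measurable]: "(\<lambda>h. \<Sum>b\<in>Basis. h b *\<^sub>R b)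
      \<in> borel_measurable (\<Pi>\<^sub>M b\<in>(Basis::'a set). lborel)"
    by measurable
  have T_inner: "(\<Prod>b\<in>Basis. g b ((\<Sum>b\<in>Basis. h b *\<^sub>R b) \<bullet> b)) = (\<Prod>b\<in>Basis. g b (h b))"
    for h :: "'a \<Rightarrow> real"
    by (rule prod.cong) auto
  have "integrable (\<Pi>\<^sub>M b\<in>(Basis::'a set). lborel) (\<lambda>h. \<Prod>b\<in>Basis. g b (h b))"
    using g_int by (intro product_integrable_prod) auto
  then have "integrable lborel (\<lambda>x. \<Prod>b\<in>Basis. g b (x \<bullet> b))"
    by (subst lborel_eq, subst integrable_distr_eq) (simp_all only: T T_inner, measurable)
  then show ?I
    unfolding std_gaussian_eq_density_prod by (subst integrable_density) (simp_all add: dens prod_nonneg)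
  have "(LINT x|std_gaussian. (\<Prod>b\<in>Basis. f b (x \<bullet> b))) = (LINT x|lborel. (\<Prod>b\<in>Basis. g b (x \<bullet> b)))"
    unfolding std_gaussian_eq_density_prod by (subst integral_density) (simp_all add: dens prod_nonneg)
  also have "\<dots> = (LINT h|(\<Pi>\<^sub>M b\<in>(Basis::'a set). lborel). (\<Prod>b\<in>Basis. g b (h b)))"
    by (subst lborel_eq, subst integral_distr) (simp_all only: T T_inner, measurable)
  also have "\<dots> = (\<Prod>b\<in>Basis. LINT y|lborel. g b y)"
    using g_int by (intro product_integral_prod) auto
  also have "\<dots> = (\<Prod>b\<in>Basis. LINT y|std_normal_distribution. f b y)"
    using f_meas by (intro prod.cong refl) (simp add: g_def integral_density)
  finally show ?E .
qed

lemma sets_std_gaussian [simp, measurable_cong]: "sets std_gaussian = sets borel"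
  and space_std_gaussian [simp]: "space std_gaussian = UNIV"
  by (simp_all add: std_gaussian_def)

lemma prob_space_std_gaussian: "prob_space (std_gaussian :: 'a::euclidean_space measure)"
proof -
  have one: "integrable std_normal_distribution (\<lambda>_. 1 :: real)"
    by (simp add: prob_space.finite_measure[OF prob_space_normal_density] finite_measure.integrable_const)
  have "integrable (std_gaussian :: 'a measure) (\<lambda>_. 1 :: real)"
    using integrable_std_gaussian_prod[where f = "\<lambda>_ _. 1 :: real", OF one] by simp
  moreover have "(LINT x|(std_gaussian :: 'a measure). (1 :: real)) = 1"
    using integral_std_gaussian_prod[where 'a = 'a and f = "\<lambda>_ _. 1 :: real", OF one]
      prob_space.prob_space[OF prob_space_normal_density[of 1 0]] by (simp del: space_density)
  ultimately show ?thesis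
    by (intro prob_spaceI) (simp add: integrable_iff_bounded emeasure_eq_ennreal_measure)
qed

interpretation std_gaussian: prob_space "std_gaussian :: 'a::euclidean_space measure"
  by (rule prob_space_std_gaussian)

lemma std_normal_moments:
  shows "integrable std_normal_distribution (\<lambda>x. x)" "(LINT x|std_normal_distribution. x) = 0"
    "integrable std_normal_distribution (\<lambda>x. x\<^sup>2)" "(LINT x|std_normal_distribution. x\<^sup>2) = 1"
  using integrable_std_normal_moment[of 1] integrable_std_normal_moment[of 2]
    integral_std_normal_moment_odd[of 0] integral_std_normal_moment_even[of 1]
  by (simp_all add: integrable_density integral_density fact_numeral)

lemma
  fixes f :: "real \<Rightarrow> real"
  assumes "b \<in> Basis" and "integrable std_normal_distribution f"
  shows integrable_std_gaussian_component: "integrable std_gaussian (\<lambda>x. f (x \<bullet> b))"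
    and integral_std_gaussian_component:
      "(LINT x|std_gaussian. f (x \<bullet> b)) = (LINT y|std_normal_distribution. f y)"
proof -
  let ?f = "\<lambda>b'. if b' = b then f else (\<lambda>_. 1)"
  have eq: "(\<Prod>b'\<in>Basis. ?f b' (x \<bullet> b')) = f (x \<bullet> b)" for x
  proof -
    have "(\<Prod>b'\<in>Basis. ?f b' (x \<bullet> b')) = (\<Prod>b'\<in>Basis. if b' = b then f (x \<bullet> b) else 1)"
      by (rule prod.cong) auto
    also have "\<dots> = f (x \<bullet> b)"
      using assms(1) by (simp add: prod.delta)
    finally show ?thesis .
  qed
  have one: "integrable std_normal_distribution (\<lambda>_. 1 :: real)" "(LINT y|std_normal_distribution. (1::real)) = 1"
    using prob_space.prob_space[OF prob_space_normal_density[of 1 0]]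
    by (simp_all add: prob_space.finite_measure[OF prob_space_normal_density] finite_measure.integrable_const del: space_density)
  have int: "integrable std_normal_distribution (?f b')" for b'
    using assms(2) one by simp
  show "integrable std_gaussian (\<lambda>x. f (x \<bullet> b))"
    using integrable_std_gaussian_prod[where f = ?f, OF int] unfolding eq .
  have "(LINT x|std_gaussian. f (x \<bullet> b)) = (\<Prod>b'\<in>Basis. LINT y|std_normal_distribution. ?f b' y)"
    using integral_std_gaussian_prod[where f = ?f, OF int] unfolding eq .
  also have "\<dots> = (\<Prod>b'\<in>Basis. if b' = b then (LINT y|std_normal_distribution. f y) else 1)"
    using one by (intro prod.cong) auto
  also have "\<dots> = (LINT y|std_normal_distribution. f y)"
    using assms(1) by (simp add: prod.delta)
  finally show "(LINT x|std_gaussian. f (x \<bullet> b)) = (LINT y|std_normal_distribution. f y)" .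
qed

lemma std_gaussian_second_moment:
  shows "integrable (std_gaussian :: 'a::euclidean_space measure) (\<lambda>x. (norm x)\<^sup>2)"
    and "(LINT x|(std_gaussian :: 'a measure). (norm x)\<^sup>2) = DIM('a)"
proof -
  note int = integrable_std_gaussian_component[where 'a = 'a, OF _ std_normal_moments(3)]
  show "integrable (std_gaussian :: 'a measure) (\<lambda>x. (norm x)\<^sup>2)"
    unfolding norm_power2_Basis by (intro Bochner_Integration.integrable_sum int)
  have "(LINT x|(std_gaussian :: 'a measure). (norm x)\<^sup>2)
      = (\<Sum>b\<in>Basis. LINT x|(std_gaussian :: 'a measure). (x \<bullet> b)\<^sup>2)"
    unfolding norm_power2_Basis by (intro Bochner_Integration.integral_sum int)
  also have "\<dots> = DIM('a)"
    using integral_std_gaussian_component[where 'a = 'a, OF _ std_normal_moments(3)]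
    by (simp add: std_normal_moments(4))
  finally show "(LINT x|(std_gaussian :: 'a measure). (norm x)\<^sup>2) = DIM('a)" .
qed

lemma std_gaussian_mean:
  fixes a :: "'a::euclidean_space"
  shows "integrable std_gaussian (\<lambda>z. a \<bullet> z)" and "(LINT z|std_gaussian. a \<bullet> z) = 0"
proof -
  have eq: "a \<bullet> z = (\<Sum>b\<in>Basis. (a \<bullet> b) * (z \<bullet> b))" for z
    by (rule euclidean_inner)
  note int = integrable_std_gaussian_component[OF _ std_normal_moments(1)]
  show "integrable std_gaussian (\<lambda>z. a \<bullet> z)"
    by (subst eq) (intro Bochner_Integration.integrable_sum integrable_mult_right int)
  have "(LINT z|std_gaussian. a \<bullet> z) = (\<Sum>b\<in>Basis. LINT z|std_gaussian. (a \<bullet> b) * (z \<bullet> b))"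
    by (subst eq) (intro Bochner_Integration.integral_sum integrable_mult_right int)
  also have "\<dots> = 0"
    using integral_std_gaussian_component[where 'a = 'a, OF _ std_normal_moments(1)]
    by (simp add: std_normal_moments(2))
  finally show "(LINT z|std_gaussian. a \<bullet> z) = 0" .
qed

lemma std_gaussian_in_P2: "std_gaussian \<in> P2"
  by (simp add: P2_def prob_space_std_gaussian std_gaussian_second_moment)

section \<open>Characteristic functions on a Euclidean space\<close>

definition charfun :: "'a::euclidean_space measure \<Rightarrow> 'a \<Rightarrow> complex" where
  "charfun \<mu> \<xi> = (LINT x|\<mu>. iexp (\<xi> \<bullet> x))"

lemma charfun_std_gaussian: "charfun std_gaussian \<xi> = of_real (exp (- (norm \<xi>)\<^sup>2 / 2))"
proof -
  let ?f = "\<lambda>b y. iexp ((\<xi> \<bullet> b) * y)"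
  interpret N: prob_space std_normal_distribution
    by (rule prob_space_normal_density) simp
  have int: "integrable std_normal_distribution (?f b)" for b
    by (rule N.integrable_const_bound[of _ 1]) (auto simp: norm_exp_i_times)
  have prod: "(\<Prod>b\<in>Basis. ?f b (x \<bullet> b)) = iexp (\<xi> \<bullet> x)" for x
    by (subst euclidean_inner) (simp add: exp_sum[symmetric] sum_distrib_left)
  have "charfun std_gaussian \<xi> = (\<Prod>b\<in>Basis. LINT y|std_normal_distribution. ?f b y)"
    using integral_std_gaussian_prod[where f = ?f, OF int] unfolding prod charfun_def .
  also have "\<dots> = (\<Prod>b\<in>Basis. of_real (exp (- (\<xi> \<bullet> b)\<^sup>2 / 2)))"
    using fun_cong[OF char_std_normal_distribution] by (intro prod.cong refl) (simp add: char_def)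
  also have "\<dots> = of_real (exp (- (norm \<xi>)\<^sup>2 / 2))"
    by (simp add: norm_power2_Basis exp_sum[symmetric] sum_negf[symmetric] sum_divide_distrib
      flip: of_real_prod)
  finally show ?thesis .
qed

text \<open>Indicators of closed sets are decreasing limits of the continuous functions
  \<open>max 0 (1 - m d(x, C))\<close>, and the closed sets form an intersection-stable generator of the Borel
  sets.\<close>

lemma measure_eqI_continuous:
  fixes \<mu> \<nu> :: "'a::metric_space measure"
  assumes "prob_space \<mu>" "prob_space \<nu>" and sets: "sets \<mu> = sets borel" "sets \<nu> = sets borel"
    and eq: "\<And>h :: 'a \<Rightarrow> real. continuous_on UNIV h \<Longrightarrow> (\<And>x. 0 \<le> h x) \<Longrightarrow> (\<And>x. h x \<le> 1) \<Longrightarrow>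
      (LINT x|\<mu>. h x) = (LINT x|\<nu>. h x)"
  shows "\<mu> = \<nu>"
proof -
  have meas: "(LINT x|\<mu>. indicator C x) = (LINT x|\<nu>. (indicator C x :: real))" if "closed C" for C
  proof (cases "C = {}")
    case False
    define h where "h m x = max 0 (1 - real m * infdist x C)" for m and x :: 'a
    have h_cont: "continuous_on UNIV (h m)" for m
      unfolding h_def by (intro continuous_intros)
    have h_range: "0 \<le> h m x" "h m x \<le> 1" for m x
      by (auto simp: h_def infdist_nonneg)
    have h_lim: "(\<lambda>m. h m x) \<longlonglongrightarrow> indicator C x" for x
    proof (cases "x \<in> C")
      case True
      then show ?thesis by (simp add: h_def)
    next
      case x: False
      then have pos: "infdist x C > 0"
        using infdist_pos_not_in_closed[OF \<open>closed C\<close> False] by blast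
      obtain N :: nat where N: "1 / infdist x C < N"
        using reals_Archimedean2 by blast
      have "h m x = 0" if "m \<ge> N" for m
      proof -
        have "1 < real N * infdist x C"
          using N pos by (simp add: field_simps)
        also have "\<dots> \<le> real m * infdist x C"
          using that pos by (intro mult_right_mono) auto
        finally show ?thesis by (simp add: h_def)
      qed
      then have "eventually (\<lambda>m. h m x = 0) sequentially"
        by (auto simp: eventually_sequentially)
      then show ?thesis
        using x by (simp add: tendsto_eventually)
    qed
    have lim: "(\<lambda>m. LINT x|M. h m x) \<longlonglongrightarrow> (LINT x|M. indicator C x)"
      if "prob_space M" and M: "sets M = sets borel" for M
    proof (rule integral_dominated_convergence[where w = "\<lambda>_. 1"])
      interpret prob_space M by fact
      show "integrable M (\<lambda>_. 1 :: real)" by simp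
      show "h m \<in> borel_measurable M" for m
        using borel_measurable_continuous_onI[OF h_cont] M by (simp cong: measurable_cong_sets)
      show "(indicator C :: 'a \<Rightarrow> real) \<in> borel_measurable M"
        using \<open>closed C\<close> M by (intro borel_measurable_indicator) auto
    qed (use h_lim h_range in auto)
    show ?thesis
      using lim[OF assms(1,3)] lim[OF assms(2,4)] eq[OF h_cont h_range]
      by (simp add: LIMSEQ_unique)
  qed simp
  interpret M: prob_space \<mu> by fact
  interpret N: prob_space \<nu> by fact
  have "emeasure \<mu> C = emeasure \<nu> C" if "closed C" for C
    using meas[OF that] that sets
    by (simp add: M.emeasure_eq_measure N.emeasure_eq_measure)
  then show ?thesis
    by (intro measure_eqI_generator_eq[where E = "Collect closed" and \<Omega> = UNIV and A = "\<lambda>_. UNIV"])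
      (auto simp: Int_stable_def sets borel_eq_closed)
qed

text \<open>Up to normalisation a Gaussian is its own characteristic function, so integrating one against \<open>\<mu>\<close> amounts, after an
  exchange of integrals, to averaging the characteristic function of \<open>\<mu>\<close> over frequencies.\<close>

lemma integral_gaussian_eq_charfun:
  fixes \<mu> :: "'a::euclidean_space measure"
  assumes "prob_space \<mu>" and [measurable_cong]: "sets \<mu> = sets borel"
  shows "of_real (LINT x|\<mu>. exp (- (norm (s *\<^sub>R (x - y)))\<^sup>2 / 2))
    = (LINT \<xi>|std_gaussian. iexp (- (s *\<^sub>R y \<bullet> \<xi>)) * charfun \<mu> (s *\<^sub>R \<xi>))"
proof -
  interpret \<mu>: prob_space \<mu> by fact
  interpret P: pair_prob_space \<mu> "std_gaussian :: 'a measure" ..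
  have "integrable (\<mu> \<Otimes>\<^sub>M std_gaussian) (\<lambda>(x, \<xi>). iexp (s *\<^sub>R (x - y) \<bullet> \<xi>))"
    by (rule P.integrable_const_bound[of _ 1]) (auto simp: norm_exp_i_times split_beta)
  note Fubini = P.Fubini_integral[OF this]
  have "of_real (LINT x|\<mu>. exp (- (norm (s *\<^sub>R (x - y)))\<^sup>2 / 2))
      = (LINT x|\<mu>. charfun std_gaussian (s *\<^sub>R (x - y)))"
    by (simp add: charfun_std_gaussian)
  also have "\<dots> = (LINT \<xi>|std_gaussian. LINT x|\<mu>. iexp (s *\<^sub>R (x - y) \<bullet> \<xi>))"
    unfolding charfun_def by (rule Fubini[symmetric])
  also have "\<dots> = (LINT \<xi>|std_gaussian. LINT x|\<mu>. iexp (- (s *\<^sub>R y \<bullet> \<xi>)) * iexp (s *\<^sub>R \<xi> \<bullet> x))"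
    by (intro Bochner_Integration.integral_cong refl)
      (simp add: exp_add[symmetric] inner_diff_left algebra_simps inner_commute)
  finally show ?thesis
    by (simp add: charfun_def)
qed

text \<open>The right-hand side is the integral of \<open>h\<close> against the density of the convolution of \<open>\<mu>\<close> with a
  Gaussian of variance \<open>\<epsilon>\<^sup>2\<close>: substitute \<open>y = x + \<epsilon>z\<close> and exchange the integrals by Tonelli's
  theorem.\<close>

lemma nn_integral_gaussian_smoothing:
  fixes h :: "'a::euclidean_space \<Rightarrow> real"
  assumes "prob_space \<mu>" and [measurable_cong]: "sets \<mu> = sets borel"
    and [measurable]: "h \<in> borel_measurable borel" and "\<epsilon> > 0"
  shows "(\<integral>\<^sup>+p. ennreal (h (fst p + \<epsilon> *\<^sub>R snd p)) \<partial>(\<mu> \<Otimes>\<^sub>M std_gaussian))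
    = (\<integral>\<^sup>+y. ennreal (h y) * ennreal ((2 * pi) powr (- real DIM('a) / 2) / \<epsilon> ^ DIM('a))
        * ennreal (LINT x|\<mu>. exp (- (norm ((1 / \<epsilon>) *\<^sub>R (x - y)))\<^sup>2 / 2)) \<partial>lborel)"
proof -
  interpret \<mu>: prob_space \<mu> by fact
  interpret P: pair_prob_space \<mu> "std_gaussian :: 'a measure" ..
  interpret Q: pair_sigma_finite \<mu> "lborel :: 'a measure" ..
  define c where "c = (2 * pi) powr (- real DIM('a) / 2)"
  have "c > 0" by (simp add: c_def)
  define F where "F x y = ennreal (h y) * ennreal (c / \<epsilon> ^ DIM('a))
    * ennreal (exp (- (norm ((1 / \<epsilon>) *\<^sub>R (x - y)))\<^sup>2 / 2))" for x y :: 'a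
  have F_meas [measurable]: "(\<lambda>p. F (fst p) (snd p)) \<in> borel_measurable (borel \<Otimes>\<^sub>M borel)"
    unfolding F_def by measurable
  have F_meas1 [measurable]: "(\<lambda>y. F x y) \<in> borel_measurable borel" for x
    unfolding F_def by measurable
  have inner: "(\<integral>\<^sup>+z. ennreal (h (x + \<epsilon> *\<^sub>R z)) \<partial>std_gaussian) = (\<integral>\<^sup>+y. F x y \<partial>lborel)" for x
  proof -
    have "(\<integral>\<^sup>+y. F x y \<partial>lborel) = (\<integral>\<^sup>+z. ennreal (\<epsilon> ^ DIM('a)) * F x (x + \<epsilon> *\<^sub>R z) \<partial>lborel)"
      by (subst lborel_affine[of \<epsilon> x])
        (use \<open>\<epsilon> > 0\<close> in \<open>simp_all add: nn_integral_density nn_integral_distr\<close>)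
    also have "\<dots> = (\<integral>\<^sup>+z. ennreal (c * exp (- (norm z)\<^sup>2 / 2)) * ennreal (h (x + \<epsilon> *\<^sub>R z)) \<partial>lborel)"
    proof (rule nn_integral_cong)
      fix z :: 'a
      have "ennreal (\<epsilon> ^ DIM('a)) * F x (x + \<epsilon> *\<^sub>R z)
          = ennreal (h (x + \<epsilon> *\<^sub>R z)) * (ennreal (\<epsilon> ^ DIM('a)) * ennreal (c / \<epsilon> ^ DIM('a))
            * ennreal (exp (- (norm z)\<^sup>2 / 2)))"
        using \<open>\<epsilon> > 0\<close> by (simp add: F_def mult_ac)
      also have "ennreal (\<epsilon> ^ DIM('a)) * ennreal (c / \<epsilon> ^ DIM('a)) * ennreal (exp (- (norm z)\<^sup>2 / 2))
          = ennreal (c * exp (- (norm z)\<^sup>2 / 2))"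
        using \<open>\<epsilon> > 0\<close> \<open>c > 0\<close> by (simp add: ennreal_mult[symmetric])
      finally show "ennreal (\<epsilon> ^ DIM('a)) * F x (x + \<epsilon> *\<^sub>R z)
          = ennreal (c * exp (- (norm z)\<^sup>2 / 2)) * ennreal (h (x + \<epsilon> *\<^sub>R z))"
        by (simp add: mult_ac)
    qed
    also have "\<dots> = (\<integral>\<^sup>+z. ennreal (h (x + \<epsilon> *\<^sub>R z)) \<partial>std_gaussian)"
      unfolding std_gaussian_def c_def[symmetric] by (subst nn_integral_density) simp_all
    finally show ?thesis ..
  qed
  have int: "integrable \<mu> (\<lambda>x. exp (- (norm ((1 / \<epsilon>) *\<^sub>R (x - y)))\<^sup>2 / 2))" for y
    by (rule \<mu>.integrable_const_bound[of _ 1]) auto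
  have "(\<integral>\<^sup>+p. ennreal (h (fst p + \<epsilon> *\<^sub>R snd p)) \<partial>(\<mu> \<Otimes>\<^sub>M std_gaussian))
      = (\<integral>\<^sup>+x. \<integral>\<^sup>+z. ennreal (h (x + \<epsilon> *\<^sub>R z)) \<partial>std_gaussian \<partial>\<mu>)"
    by (subst std_gaussian.nn_integral_fst[symmetric]) simp_all
  also have "\<dots> = (\<integral>\<^sup>+x. \<integral>\<^sup>+y. F x y \<partial>lborel \<partial>\<mu>)"
    by (simp only: inner)
  also have "\<dots> = (\<integral>\<^sup>+y. \<integral>\<^sup>+x. F x y \<partial>\<mu> \<partial>lborel)"
    by (rule Q.Fubini'[symmetric]) (simp add: split_beta)
  also have "\<dots> = (\<integral>\<^sup>+y. ennreal (h y) * ennreal (c / \<epsilon> ^ DIM('a))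
        * ennreal (LINT x|\<mu>. exp (- (norm ((1 / \<epsilon>) *\<^sub>R (x - y)))\<^sup>2 / 2)) \<partial>lborel)"
    unfolding F_def
    by (intro nn_integral_cong, subst nn_integral_cmult) (measurable, simp add: nn_integral_eq_integral[OF int, simplified])
  finally show ?thesis
    unfolding c_def .
qed

text \<open>The characteristic function determines the convolution of the measure with every Gaussian, and
  these convolutions converge weakly to the measure as the variance tends to \<open>0\<close>.\<close>

theorem charfun_unique:
  fixes \<mu> \<nu> :: "'a::euclidean_space measure"
  assumes "prob_space \<mu>" "prob_space \<nu>" and "sets \<mu> = sets borel" "sets \<nu> = sets borel"
    and eq: "\<And>\<xi>. charfun \<mu> \<xi> = charfun \<nu> \<xi>"
  shows "\<mu> = \<nu>"
proof (rule measure_eqI_continuous[OF assms(1-4)])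
  fix h :: "'a \<Rightarrow> real"
  assume cont: "continuous_on UNIV h" and nonneg: "\<And>x. 0 \<le> h x" and le1: "\<And>x. h x \<le> 1"
  have h [measurable]: "h \<in> borel_measurable borel"
    by (rule borel_measurable_continuous_onI[OF cont])
  define S where "S M k = (LINT p|(M \<Otimes>\<^sub>M (std_gaussian :: 'a measure)).
    h (fst p + (1 / real (Suc k)) *\<^sub>R snd p))" for M k
  have lim: "S M \<longlonglongrightarrow> (LINT x|M. h x)" if "prob_space M" and M [measurable_cong]: "sets M = sets borel" for M
  proof -
    interpret M: prob_space M by fact
    interpret P: pair_prob_space M "std_gaussian :: 'a measure" ..
    have "S M \<longlonglongrightarrow> (LINT p|(M \<Otimes>\<^sub>M (std_gaussian :: 'a measure)). h (fst p))"
      unfolding S_def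
    proof (rule integral_dominated_convergence[where w = "\<lambda>_. 1"])
      show "AE p in M \<Otimes>\<^sub>M (std_gaussian :: 'a measure).
        (\<lambda>k. h (fst p + (1 / real (Suc k)) *\<^sub>R snd p)) \<longlonglongrightarrow> h (fst p)"
      proof (intro AE_I2)
        fix p :: "'a \<times> 'a"
        have "(\<lambda>k. fst p + (1 / real (Suc k)) *\<^sub>R snd p) \<longlonglongrightarrow> fst p + 0 *\<^sub>R snd p"
          by (intro tendsto_intros LIMSEQ_Suc[OF lim_1_over_n])
        then show "(\<lambda>k. h (fst p + (1 / real (Suc k)) *\<^sub>R snd p)) \<longlonglongrightarrow> h (fst p)"
          using cont by (intro continuous_on_tendsto_compose[where f = h and s = UNIV]) auto
      qed
    qed (use nonneg le1 in auto)
    also have "(LINT p|(M \<Otimes>\<^sub>M (std_gaussian :: 'a measure)). h (fst p)) = (LINT x|M. h x)"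
    proof -
      have "integrable (M \<Otimes>\<^sub>M (std_gaussian :: 'a measure)) (\<lambda>p. h (fst p))"
        by (rule P.integrable_const_bound[of _ 1]) (use nonneg le1 in auto)
      from P.integral_fst'[OF this] show ?thesis
        using std_gaussian.prob_space[where 'a = 'a] by simp
    qed
    finally show ?thesis .
  qed
  have "S \<mu> k = S \<nu> k" for k
  proof -
    let ?\<epsilon> = "1 / real (Suc k)"
    have "(LINT x|\<mu>. exp (- (norm ((1 / ?\<epsilon>) *\<^sub>R (x - y)))\<^sup>2 / 2))
        = (LINT x|\<nu>. exp (- (norm ((1 / ?\<epsilon>) *\<^sub>R (x - y)))\<^sup>2 / 2))" for y
    proof -
      have "complex_of_real (LINT x|\<mu>. exp (- (norm ((1 / ?\<epsilon>) *\<^sub>R (x - y)))\<^sup>2 / 2))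
          = complex_of_real (LINT x|\<nu>. exp (- (norm ((1 / ?\<epsilon>) *\<^sub>R (x - y)))\<^sup>2 / 2))"
        by (simp only: integral_gaussian_eq_charfun[OF assms(1,3)]
          integral_gaussian_eq_charfun[OF assms(2,4)] eq)
      then show ?thesis
        by (simp only: of_real_eq_iff)
    qed
    then have "(\<integral>\<^sup>+p. ennreal (h (fst p + ?\<epsilon> *\<^sub>R snd p)) \<partial>(\<mu> \<Otimes>\<^sub>M std_gaussian))
        = (\<integral>\<^sup>+p. ennreal (h (fst p + ?\<epsilon> *\<^sub>R snd p)) \<partial>(\<nu> \<Otimes>\<^sub>M std_gaussian))"
      by (simp only: nn_integral_gaussian_smoothing[OF assms(1,3) h, of ?\<epsilon>]
        nn_integral_gaussian_smoothing[OF assms(2,4) h, of ?\<epsilon>] zero_less_divide_1_iff of_nat_0_less_iff zero_less_Suc)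
    moreover note [measurable_cong] = assms(3,4)
    ultimately show ?thesis
      unfolding S_def by (subst (1 2) integral_eq_nn_integral) (simp_all add: nonneg)
  qed
  then have "S \<mu> = S \<nu>" by auto
  with lim[OF assms(1,3)] lim[OF assms(2,4)] show "(LINT x|\<mu>. h x) = (LINT x|\<nu>. h x)"
    using LIMSEQ_unique by metis
qed

section \<open>Couplings and the Wasserstein distance\<close>

lemma P2_D:
  assumes "\<mu> \<in> P2"
  shows "prob_space \<mu>" "sets \<mu> = sets borel" "integrable \<mu> (\<lambda>x. (norm x)\<^sup>2)"
  using assms by (auto simp: P2_def)

lemma sets_couplings: "\<pi> \<in> couplings \<mu> \<nu> \<Longrightarrow> sets \<pi> = sets borel"
  by (simp add: couplings_def)

lemma
  assumes "\<pi> \<in> couplings \<mu> \<nu>"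
  shows distr_fst_couplings: "distr \<pi> borel fst = \<mu>"
    and distr_snd_couplings: "distr \<pi> borel snd = \<nu>"
  using assms by (auto simp: couplings_def)

lemma measurable_couplings:
  assumes "\<pi> \<in> couplings \<mu> \<nu>"
  shows "fst \<in> borel_measurable \<pi>" "snd \<in> borel_measurable \<pi>"
  using sets_couplings[OF assms] by (simp_all cong: measurable_cong_sets add: borel_prod[symmetric])

lemma prob_space_couplings:
  assumes "\<pi> \<in> couplings \<mu> \<nu>" and "prob_space \<mu>"
  shows "prob_space \<pi>"
  using assms(2) prob_space_distrD[OF measurable_couplings(1)[OF assms(1)]]
  by (simp add: distr_fst_couplings[OF assms(1)])

lemma
  fixes f :: "'a::euclidean_space \<Rightarrow> 'b::{banach,second_countable_topology}"
  assumes \<pi>: "\<pi> \<in> couplings \<mu> \<nu>" and f: "f \<in> borel_measurable borel"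
  shows integral_fst_couplings: "(LINT z|\<pi>. f (fst z)) = (LINT x|\<mu>. f x)"
    and integral_snd_couplings: "(LINT z|\<pi>. f (snd z)) = (LINT y|\<nu>. f y)"
    and integrable_fst_couplings: "integrable \<mu> f \<Longrightarrow> integrable \<pi> (\<lambda>z. f (fst z))"
    and integrable_snd_couplings: "integrable \<nu> f \<Longrightarrow> integrable \<pi> (\<lambda>z. f (snd z))"
proof -
  note m = measurable_couplings[OF \<pi>]
  show "(LINT z|\<pi>. f (fst z)) = (LINT x|\<mu>. f x)"
    using integral_distr[OF m(1) f] by (simp add: distr_fst_couplings[OF \<pi>])
  show "(LINT z|\<pi>. f (snd z)) = (LINT y|\<nu>. f y)"
    using integral_distr[OF m(2) f] by (simp add: distr_snd_couplings[OF \<pi>])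
  show "integrable \<pi> (\<lambda>z. f (fst z))" if "integrable \<mu> f"
    using integrable_distr_eq[OF m(1) f] that by (simp add: distr_fst_couplings[OF \<pi>])
  show "integrable \<pi> (\<lambda>z. f (snd z))" if "integrable \<nu> f"
    using integrable_distr_eq[OF m(2) f] that by (simp add: distr_snd_couplings[OF \<pi>])
qed

lemma norm_power2_expand:
  "(norm (a *\<^sub>R x + b *\<^sub>R y))\<^sup>2 = a\<^sup>2 * (norm x)\<^sup>2 + b\<^sup>2 * (norm y)\<^sup>2 + 2 * a * b * (x \<bullet> y)"
  for x y :: "'a::real_inner"
  unfolding power2_norm_eq_inner
  by (simp add: inner_add_left inner_add_right inner_commute power2_eq_square algebra_simps)

lemma
  assumes \<pi>: "\<pi> \<in> couplings \<mu> \<nu>" and "\<mu> \<in> P2" "\<nu> \<in> P2"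
  shows integrable_norm_snd_couplings: "integrable \<pi> (\<lambda>z. (norm (snd z))\<^sup>2)"
    and integrable_inner_couplings: "integrable \<pi> (\<lambda>z. fst z \<bullet> snd z)"
    and integrable_combination_couplings: "integrable \<pi> (\<lambda>z. (norm (a *\<^sub>R fst z + b *\<^sub>R snd z))\<^sup>2)"
    and integral_combination_couplings:
      "(LINT z|\<pi>. (norm (a *\<^sub>R fst z + b *\<^sub>R snd z))\<^sup>2)
        = a\<^sup>2 * (LINT x|\<mu>. (norm x)\<^sup>2) + b\<^sup>2 * (LINT y|\<nu>. (norm y)\<^sup>2)
          + 2 * a * b * (LINT z|\<pi>. fst z \<bullet> snd z)"
proof -
  note [measurable] = measurable_couplings[OF \<pi>]
  have meas: "(\<lambda>x::'a. (norm x)\<^sup>2) \<in> borel_measurable borel"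
    by measurable
  have 1: "integrable \<pi> (\<lambda>z. (norm (fst z))\<^sup>2)"
    by (rule integrable_fst_couplings[OF \<pi> meas P2_D(3)]) fact
  show 2: "integrable \<pi> (\<lambda>z. (norm (snd z))\<^sup>2)"
    by (rule integrable_snd_couplings[OF \<pi> meas P2_D(3)]) fact
  show 3: "integrable \<pi> (\<lambda>z. fst z \<bullet> snd z)"
  proof (rule Bochner_Integration.integrable_bound)
    show "integrable \<pi> (\<lambda>z. (norm (fst z))\<^sup>2 + (norm (snd z))\<^sup>2)"
      using 1 2 by simp
    have "\<bar>x \<bullet> y\<bar> \<le> (norm x)\<^sup>2 + (norm y)\<^sup>2" for x y :: 'a
    proof -
      have "\<bar>x \<bullet> y\<bar> \<le> norm x * norm y" by (rule Cauchy_Schwarz_ineq2)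
      moreover have "0 \<le> (norm x - norm y)\<^sup>2" "0 \<le> norm x * norm y" by simp_all
      ultimately show ?thesis by (simp add: power2_diff)
    qed
    then show "AE z in \<pi>. norm (fst z \<bullet> snd z) \<le> norm ((norm (fst z))\<^sup>2 + (norm (snd z))\<^sup>2)"
      by simp
  qed measurable
  show "integrable \<pi> (\<lambda>z. (norm (a *\<^sub>R fst z + b *\<^sub>R snd z))\<^sup>2)"
    unfolding norm_power2_expand using 1 2 3 by simp
  show "(LINT z|\<pi>. (norm (a *\<^sub>R fst z + b *\<^sub>R snd z))\<^sup>2)
        = a\<^sup>2 * (LINT x|\<mu>. (norm x)\<^sup>2) + b\<^sup>2 * (LINT y|\<nu>. (norm y)\<^sup>2)
          + 2 * a * b * (LINT z|\<pi>. fst z \<bullet> snd z)"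
    unfolding norm_power2_expand using 1 2 3
    by (simp add: integral_fst_couplings[OF \<pi> meas] integral_snd_couplings[OF \<pi> meas])
qed

lemma cost_couplings:
  assumes "\<pi> \<in> couplings \<mu> \<nu>" "\<mu> \<in> P2" "\<nu> \<in> P2"
  shows "integrable \<pi> (\<lambda>z. (norm (snd z - fst z))\<^sup>2)"
    and "(LINT z|\<pi>. (norm (snd z - fst z))\<^sup>2)
      = (LINT x|\<mu>. (norm x)\<^sup>2) + (LINT y|\<nu>. (norm y)\<^sup>2) - 2 * (LINT z|\<pi>. fst z \<bullet> snd z)"
  using integrable_combination_couplings[OF assms, of "- 1" 1]
    integral_combination_couplings[OF assms, of "- 1" 1]
  by simp_all

lemma product_in_couplings:
  fixes \<mu> \<nu> :: "'a::euclidean_space measure"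
  assumes "prob_space \<mu>" "prob_space \<nu>" "sets \<mu> = sets borel" "sets \<nu> = sets borel"
  shows "\<mu> \<Otimes>\<^sub>M \<nu> \<in> couplings \<mu> \<nu>"
proof -
  interpret pair_prob_space \<mu> \<nu>
    using assms by (simp add: pair_prob_space_def pair_sigma_finite_def prob_space_imp_sigma_finite)
  have "sets (\<mu> \<Otimes>\<^sub>M \<nu>) = sets borel"
    by (subst sets_pair_measure_cong[OF assms(3,4)]) (simp only: borel_prod)
  moreover have "distr (\<mu> \<Otimes>\<^sub>M \<nu>) borel fst = \<mu>"
    using M2.distr_pair_fst[of \<mu>] assms(3) by (simp cong: distr_cong)
  moreover have "distr (\<mu> \<Otimes>\<^sub>M \<nu>) borel snd = \<nu>"
  proof (rule measure_eqI)
    fix A assume "A \<in> sets (distr (\<mu> \<Otimes>\<^sub>M \<nu>) borel snd)"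
    then have A: "A \<in> sets \<nu>" using assms(4) by simp
    have "snd \<in> measurable (\<mu> \<Otimes>\<^sub>M \<nu>) borel"
      using assms(4) measurable_snd[of \<mu> \<nu>] by (simp cong: measurable_cong_sets)
    then have "emeasure (distr (\<mu> \<Otimes>\<^sub>M \<nu>) borel snd) A = emeasure (\<mu> \<Otimes>\<^sub>M \<nu>) (space \<mu> \<times> A)"
      using A assms(4) sets.sets_into_space[OF A]
      by (auto simp: emeasure_distr space_pair_measure intro!: arg_cong2[where f = emeasure])
    then show "emeasure (distr (\<mu> \<Otimes>\<^sub>M \<nu>) borel snd) A = emeasure \<nu> A"
      using A by (simp add: M2.emeasure_pair_measure_Times M1.emeasure_space_1)
  qed (simp add: assms(4))
  ultimately show ?thesis
    by (simp add: couplings_def)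
qed

lemma cost_nonneg: "0 \<le> (LINT z|\<pi>. (norm (snd z - fst z))\<^sup>2)"
  by (rule Bochner_Integration.integral_nonneg) simp

lemma W2_le:
  assumes "\<pi> \<in> couplings \<mu> \<nu>"
  shows "W2 \<mu> \<nu> \<le> sqrt (LINT z|\<pi>. (norm (snd z - fst z))\<^sup>2)"
  unfolding W2_def by (rule cINF_lower[OF _ assms]) (auto intro!: bdd_belowI[of _ 0] cost_nonneg)

lemma couplings_nonempty: "\<mu> \<in> P2 \<Longrightarrow> \<nu> \<in> P2 \<Longrightarrow> couplings \<mu> \<nu> \<noteq> {}"
  using product_in_couplings[of \<mu> \<nu>] by (auto simp: P2_def)

lemma W2_nonneg:
  assumes "couplings \<mu> \<nu> \<noteq> {}"
  shows "0 \<le> W2 \<mu> \<nu>"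
  unfolding W2_def by (rule cINF_greatest[OF assms]) (auto intro: cost_nonneg)

lemma W2_less_obtain:
  assumes "couplings \<mu> \<nu> \<noteq> {}" and "W2 \<mu> \<nu> < c"
  obtains \<pi> where "\<pi> \<in> couplings \<mu> \<nu>" "(LINT z|\<pi>. (norm (snd z - fst z))\<^sup>2) < c\<^sup>2"
proof -
  have "\<exists>\<pi>\<in>couplings \<mu> \<nu>. sqrt (LINT z|\<pi>. (norm (snd z - fst z))\<^sup>2) < c"
    using assms unfolding W2_def
    by (subst (asm) cINF_less_iff) (auto intro!: bdd_belowI[of _ 0] cost_nonneg)
  then obtain \<pi> where \<pi>: "\<pi> \<in> couplings \<mu> \<nu>" "sqrt (LINT z|\<pi>. (norm (snd z - fst z))\<^sup>2) < c"
    by blast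
  have "(sqrt (LINT z|\<pi>. (norm (snd z - fst z))\<^sup>2))\<^sup>2 < c\<^sup>2"
    using \<pi>(2) by (intro power_strict_mono) (auto intro: cost_nonneg)
  then show ?thesis
    using that[OF \<pi>(1)] by (simp add: cost_nonneg)
qed

lemma W2_power2_le:
  assumes "\<pi> \<in> couplings \<mu> \<nu>"
  shows "(W2 \<mu> \<nu>)\<^sup>2 \<le> (LINT z|\<pi>. (norm (snd z - fst z))\<^sup>2)"
proof -
  have "(W2 \<mu> \<nu>)\<^sup>2 \<le> (sqrt (LINT z|\<pi>. (norm (snd z - fst z))\<^sup>2))\<^sup>2"
    using W2_le[OF assms] assms by (intro power_mono W2_nonneg) auto
  then show ?thesis
    by (simp add: cost_nonneg)
qed

lemma W2_power2_approx:
  assumes "couplings \<mu> \<nu> \<noteq> {}" and "(W2 \<mu> \<nu>)\<^sup>2 < c"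
  obtains \<pi> where "\<pi> \<in> couplings \<mu> \<nu>" "(LINT z|\<pi>. (norm (snd z - fst z))\<^sup>2) < c"
proof -
  have "0 < c" using assms(2) by (meson le_less_trans zero_le_power2)
  moreover have "W2 \<mu> \<nu> < sqrt c"
    using assms(2) by (rule real_less_rsqrt)
  ultimately show ?thesis
    using W2_less_obtain[OF assms(1), of "sqrt c"] that by (metis less_imp_le real_sqrt_pow2)
qed

text \<open>Adding an independent Gaussian multiplies the characteristic function by a Gaussian factor and, as
  the cross term integrates to \<open>0\<close>, adds its second moment.\<close>

lemma
  fixes f :: "'b \<Rightarrow> 'a::euclidean_space"
  assumes "prob_space M" and [measurable]: "f \<in> borel_measurable M"
  shows charfun_add_gaussian:
      "charfun (distr (M \<Otimes>\<^sub>M std_gaussian) borel (\<lambda>q. f (fst q) + k *\<^sub>R snd q)) \<xi>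
        = (LINT w|M. iexp (\<xi> \<bullet> f w)) * of_real (exp (- k\<^sup>2 * (norm \<xi>)\<^sup>2 / 2))"
    and second_moment_add_gaussian:
      "integrable M (\<lambda>w. (norm (f w))\<^sup>2) \<Longrightarrow>
        (LINT q|(M \<Otimes>\<^sub>M std_gaussian). (norm (f (fst q) + k *\<^sub>R snd q))\<^sup>2)
          = (LINT w|M. (norm (f w))\<^sup>2) + k\<^sup>2 * DIM('a)"
proof -
  interpret M: prob_space M by fact
  interpret P: pair_prob_space M "std_gaussian :: 'a measure" ..
  have "charfun (distr (M \<Otimes>\<^sub>M std_gaussian) borel (\<lambda>q. f (fst q) + k *\<^sub>R snd q)) \<xi>
      = (LINT q|(M \<Otimes>\<^sub>M std_gaussian). iexp (\<xi> \<bullet> (f (fst q) + k *\<^sub>R snd q)))"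
    unfolding charfun_def by (subst integral_distr) simp_all
  also have "\<dots> = (LINT w|M. LINT z|std_gaussian. iexp (\<xi> \<bullet> (f w + k *\<^sub>R z)))"
    by (subst P.integral_fst'[symmetric])
      (auto intro!: P.integrable_const_bound[of _ 1] simp: norm_exp_i_times)
  also have "\<dots> = (LINT w|M. iexp (\<xi> \<bullet> f w) * charfun std_gaussian (k *\<^sub>R \<xi>))"
  proof (intro Bochner_Integration.integral_cong refl)
    fix w
    have "(LINT z|std_gaussian. iexp (\<xi> \<bullet> (f w + k *\<^sub>R z)))
        = (LINT z|std_gaussian. iexp (\<xi> \<bullet> f w) * iexp (k *\<^sub>R \<xi> \<bullet> z))"
      by (simp add: inner_add_right exp_add distrib_left)
    then show "(LINT z|std_gaussian. iexp (\<xi> \<bullet> (f w + k *\<^sub>R z)))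
        = iexp (\<xi> \<bullet> f w) * charfun std_gaussian (k *\<^sub>R \<xi>)"
      by (simp add: charfun_def)
  qed
  also have "\<dots> = (LINT w|M. iexp (\<xi> \<bullet> f w)) * of_real (exp (- k\<^sup>2 * (norm \<xi>)\<^sup>2 / 2))"
    by (simp add: charfun_std_gaussian power_mult_distrib)
  finally show "charfun (distr (M \<Otimes>\<^sub>M std_gaussian) borel (\<lambda>q. f (fst q) + k *\<^sub>R snd q)) \<xi>
        = (LINT w|M. iexp (\<xi> \<bullet> f w)) * of_real (exp (- k\<^sup>2 * (norm \<xi>)\<^sup>2 / 2))" .

  assume f: "integrable M (\<lambda>w. (norm (f w))\<^sup>2)"
  have expand: "(norm (f w + k *\<^sub>R z))\<^sup>2 = (norm (f w))\<^sup>2 + k\<^sup>2 * (norm z)\<^sup>2 + 2 * k * (f w \<bullet> z)" for w z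
    using norm_power2_expand[of 1 "f w" k z] by simp
  note moments = std_gaussian_second_moment[where 'a = 'a] std_gaussian_mean[where 'a = 'a]
    std_gaussian.prob_space[where 'a = 'a]
  have inner_int: "integrable std_gaussian (\<lambda>z. (norm (f w + k *\<^sub>R z))\<^sup>2)" for w
    unfolding expand using moments by simp
  have inner: "(LINT z|std_gaussian. (norm (f w + k *\<^sub>R z))\<^sup>2) = (norm (f w))\<^sup>2 + k\<^sup>2 * DIM('a)" for w
    unfolding expand using moments by simp
  have "integrable (M \<Otimes>\<^sub>M (std_gaussian :: 'a measure)) (\<lambda>q. (norm (f (fst q) + k *\<^sub>R snd q))\<^sup>2)"
    by (rule P.Fubini_integrable) (use f in \<open>simp_all add: inner inner_int\<close>)
  from P.integral_fst'[OF this]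
  have "(LINT q|(M \<Otimes>\<^sub>M std_gaussian). (norm (f (fst q) + k *\<^sub>R snd q))\<^sup>2)
      = (LINT w|M. LINT z|std_gaussian. (norm (f w + k *\<^sub>R z))\<^sup>2)"
    by simp
  also have "\<dots> = (LINT w|M. (norm (f w))\<^sup>2 + k\<^sup>2 * DIM('a))"
    by (simp only: inner)
  also have "\<dots> = (LINT w|M. (norm (f w))\<^sup>2) + k\<^sup>2 * DIM('a)"
    using f M.prob_space by simp
  finally show "(LINT q|(M \<Otimes>\<^sub>M std_gaussian). (norm (f (fst q) + k *\<^sub>R snd q))\<^sup>2)
      = (LINT w|M. (norm (f w))\<^sup>2) + k\<^sup>2 * DIM('a)" .
qed

text \<open>If \<open>(X, G)\<close> has law \<open>\<pi>\<close> and \<open>Z\<close> is an independent standard Gaussian, then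
  \<open>pX + rZ\<close> and \<open>cG + sZ\<close> have laws \<open>\<nu>\<close> and \<open>\<gamma>\<close> by comparison of characteristic functions. Their
  difference is \<open>(pX - cG) + (r - s)Z\<close>, whose second moment splits by independence. The mixed moment
  of \<open>X\<close> and \<open>G\<close> is expressed through the cost of \<open>\<pi>\<close>.\<close>

lemma W2_gaussian_correlated_coupling:
  fixes \<mu> \<nu> :: "'a::euclidean_space measure" and p r c s :: real
  assumes \<mu>: "\<mu> \<in> P2" and \<nu>: "prob_space \<nu>" "sets \<nu> = sets borel"
    and charfun: "\<And>\<xi>. charfun \<nu> \<xi> = charfun \<mu> (p *\<^sub>R \<xi>) * of_real (exp (- r\<^sup>2 * (norm \<xi>)\<^sup>2 / 2))"
    and \<pi>: "\<pi> \<in> couplings \<mu> std_gaussian" and cs: "c\<^sup>2 + s\<^sup>2 = 1"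
  shows "(W2 \<nu> std_gaussian)\<^sup>2 \<le> p\<^sup>2 * (LINT x|\<mu>. (norm x)\<^sup>2) + c\<^sup>2 * DIM('a)
    - p * c * ((LINT x|\<mu>. (norm x)\<^sup>2) + DIM('a) - (LINT z|\<pi>. (norm (snd z - fst z))\<^sup>2))
    + (s - r)\<^sup>2 * DIM('a)"
proof -
  let ?\<gamma> = "std_gaussian :: 'a measure"
  interpret \<pi>: prob_space \<pi>
    using prob_space_couplings[OF \<pi>] P2_D(1)[OF \<mu>] .
  interpret P: pair_prob_space \<pi> ?\<gamma> ..
  note [measurable] = measurable_couplings[OF \<pi>]
  define X where "X q = p *\<^sub>R fst (fst q) + r *\<^sub>R snd q" for q :: "('a \<times> 'a) \<times> 'a"
  define Y where "Y q = c *\<^sub>R snd (fst q) + s *\<^sub>R snd q" for q :: "('a \<times> 'a) \<times> 'a"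
  have [measurable]: "X \<in> borel_measurable (\<pi> \<Otimes>\<^sub>M ?\<gamma>)" "Y \<in> borel_measurable (\<pi> \<Otimes>\<^sub>M ?\<gamma>)"
    unfolding X_def Y_def by measurable
  have X: "distr (\<pi> \<Otimes>\<^sub>M ?\<gamma>) borel X = \<nu>"
  proof (rule charfun_unique)
    show "charfun (distr (\<pi> \<Otimes>\<^sub>M ?\<gamma>) borel X) \<xi> = charfun \<nu> \<xi>" for \<xi>
    proof -
      have "(LINT w|\<pi>. iexp (\<xi> \<bullet> p *\<^sub>R fst w)) = charfun \<mu> (p *\<^sub>R \<xi>)"
        using integral_fst_couplings[OF \<pi>, of "\<lambda>x. iexp (\<xi> \<bullet> p *\<^sub>R x)"] by (simp add: charfun_def)
      then show ?thesis
        unfolding X_def charfun by (subst charfun_add_gaussian) (auto simp: \<pi>.prob_space_axioms)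
    qed
  qed (use \<nu> in \<open>auto intro: P.prob_space_distr\<close>)
  have Y: "distr (\<pi> \<Otimes>\<^sub>M ?\<gamma>) borel Y = ?\<gamma>"
  proof (rule charfun_unique)
    show "charfun (distr (\<pi> \<Otimes>\<^sub>M ?\<gamma>) borel Y) \<xi> = charfun ?\<gamma> \<xi>" for \<xi>
    proof -
      have "(LINT w|\<pi>. iexp (\<xi> \<bullet> c *\<^sub>R snd w)) = charfun ?\<gamma> (c *\<^sub>R \<xi>)"
        using integral_snd_couplings[OF \<pi>, of "\<lambda>x. iexp (\<xi> \<bullet> c *\<^sub>R x)"] by (simp add: charfun_def)
      moreover have "exp (- (c\<^sup>2 * (norm \<xi>)\<^sup>2) / 2) * exp (- s\<^sup>2 * (norm \<xi>)\<^sup>2 / 2) = exp (- (norm \<xi>)\<^sup>2 / 2)"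
      proof -
        have "- (c\<^sup>2 * (norm \<xi>)\<^sup>2) / 2 + - s\<^sup>2 * (norm \<xi>)\<^sup>2 / 2 = - ((c\<^sup>2 + s\<^sup>2) * (norm \<xi>)\<^sup>2) / 2"
          by (simp add: field_simps)
        then show ?thesis using cs by (simp add: exp_add[symmetric])
      qed
      ultimately show ?thesis
        unfolding Y_def
        by (subst charfun_add_gaussian)
          (simp_all add: \<pi>.prob_space_axioms charfun_std_gaussian power_mult_distrib flip: of_real_mult)
    qed
  qed (auto intro: P.prob_space_distr prob_space_std_gaussian)
  define Q where "Q = distr (\<pi> \<Otimes>\<^sub>M ?\<gamma>) borel (\<lambda>q. (X q, Y q))"
  have XY [measurable]: "(\<lambda>q. (X q, Y q)) \<in> borel_measurable (\<pi> \<Otimes>\<^sub>M ?\<gamma>)"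
    by measurable
  have "Q \<in> couplings \<nu> ?\<gamma>"
    unfolding couplings_def Q_def using X Y
    by (auto simp: distr_distr comp_def borel_prod[symmetric])
  then have "(W2 \<nu> ?\<gamma>)\<^sup>2 \<le> (LINT z|Q. (norm (snd z - fst z))\<^sup>2)"
    by (rule W2_power2_le)
  also have "\<dots> = (LINT q|(\<pi> \<Otimes>\<^sub>M ?\<gamma>). (norm (Y q - X q))\<^sup>2)"
    unfolding Q_def by (subst integral_distr) (simp_all add: borel_prod[symmetric])
  also have "\<dots> = (LINT q|(\<pi> \<Otimes>\<^sub>M ?\<gamma>). (norm (((- p) *\<^sub>R fst (fst q) + c *\<^sub>R snd (fst q)) + (s - r) *\<^sub>R snd q))\<^sup>2)"
    by (intro Bochner_Integration.integral_cong refl arg_cong[where f = "\<lambda>x. (norm x)\<^sup>2"])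
      (simp add: X_def Y_def algebra_simps)
  also have "\<dots> = (LINT w|\<pi>. (norm ((- p) *\<^sub>R fst w + c *\<^sub>R snd w))\<^sup>2) + (s - r)\<^sup>2 * DIM('a)"
    by (rule second_moment_add_gaussian[OF \<pi>.prob_space_axioms _
          integrable_combination_couplings[OF \<pi> \<mu> std_gaussian_in_P2]]) measurable
  also have "(LINT w|\<pi>. (norm ((- p) *\<^sub>R fst w + c *\<^sub>R snd w))\<^sup>2)
      = p\<^sup>2 * (LINT x|\<mu>. (norm x)\<^sup>2) + c\<^sup>2 * DIM('a)
        - p * c * ((LINT x|\<mu>. (norm x)\<^sup>2) + DIM('a) - (LINT z|\<pi>. (norm (snd z - fst z))\<^sup>2))"
    unfolding integral_combination_couplings[OF \<pi> \<mu> std_gaussian_in_P2]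
      cost_couplings(2)[OF \<pi> \<mu> std_gaussian_in_P2] std_gaussian_second_moment(2)
    by (simp add: algebra_simps)
  finally show ?thesis .
qed

text \<open>The cost of the product coupling, as \<open>\<gamma>\<close> is centred. The bound keeps the correlation
  \<open>\<rho>\<close> nonnegative and the denominators of the final estimate positive.\<close>

lemma W2_gaussian_le:
  fixes \<mu> :: "'a::euclidean_space measure"
  assumes \<mu>: "\<mu> \<in> P2"
  shows "(W2 \<mu> std_gaussian)\<^sup>2 \<le> (LINT x|\<mu>. (norm x)\<^sup>2) + DIM('a)"
proof -
  let ?\<gamma> = "std_gaussian :: 'a measure"
  interpret \<mu>: prob_space \<mu> using P2_D[OF \<mu>] by simp
  interpret P: pair_prob_space \<mu> ?\<gamma> ..
  have \<pi>: "\<mu> \<Otimes>\<^sub>M ?\<gamma> \<in> couplings \<mu> ?\<gamma>"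
    using P2_D[OF \<mu>] by (intro product_in_couplings prob_space_std_gaussian) auto
  have "(LINT z|(\<mu> \<Otimes>\<^sub>M ?\<gamma>). fst z \<bullet> snd z) = 0"
    using P.integral_fst'[OF integrable_inner_couplings[OF \<pi> \<mu> std_gaussian_in_P2]]
    by (simp add: std_gaussian_mean)
  then show ?thesis
    using W2_power2_le[OF \<pi>] cost_couplings(2)[OF \<pi> \<mu> std_gaussian_in_P2]
    by (simp add: std_gaussian_second_moment)
qed

section \<open>Integrals along a continuous curve in the Wasserstein space\<close>

text \<open>Where \<open>|y| \<le> K\<close> and \<open>|y - x| < \<delta>\<close>, uniform continuity on a compact set makes the difference at most
  \<open>e\<close>; elsewhere the trivial bound \<open>2M\<close> is absorbed by one of the quadratic terms. These terms have
  small integrals against a coupling of small cost, so this single pointwise inequality replaces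
  arguments by tightness and weak convergence.\<close>

lemma bounded_continuous_oscillation:
  fixes F :: "real \<times> 'a::euclidean_space \<Rightarrow> real"
  assumes cont: "continuous_on UNIV F" and bound: "\<And>p. \<bar>F p\<bar> \<le> M" and pos: "0 < e" "0 < K"
  obtains \<delta> where "0 < \<delta>" "\<And>s x y. \<bar>s - t\<bar> < \<delta> \<Longrightarrow>
    \<bar>F (s, x) - F (t, y)\<bar> \<le> e + 2 * M * ((norm y)\<^sup>2 / K\<^sup>2 + (norm (y - x))\<^sup>2 / \<delta>\<^sup>2)"
proof -
  have M: "0 \<le> M" using bound[of undefined] by (meson abs_ge_zero order_trans)
  let ?S = "{t - 1..t + 1} \<times> cball (0 :: 'a) (K + 1)"
  have "uniformly_continuous_on ?S F"
    using continuous_on_subset[OF cont] by (intro compact_uniformly_continuous compact_Times) auto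
  then obtain d where d: "0 < d"
    and unif: "\<And>p p'. p \<in> ?S \<Longrightarrow> p' \<in> ?S \<Longrightarrow> dist p' p < d \<Longrightarrow> dist (F p') (F p) < e"
    unfolding uniformly_continuous_on_def using pos(1) by meson
  define \<delta> where "\<delta> = min 1 (d / 2)"
  have \<delta>: "0 < \<delta>" "\<delta> \<le> 1" "\<delta> \<le> d / 2" using d by (auto simp: \<delta>_def)
  show ?thesis
  proof (rule that[of \<delta>])
    fix s and x y :: 'a
    assume s: "\<bar>s - t\<bar> < \<delta>"
    show "\<bar>F (s, x) - F (t, y)\<bar> \<le> e + 2 * M * ((norm y)\<^sup>2 / K\<^sup>2 + (norm (y - x))\<^sup>2 / \<delta>\<^sup>2)"
    proof (cases "norm y \<le> K \<and> norm (y - x) < \<delta>")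
      case True
      have "norm x \<le> norm y + norm (y - x)"
        by (metis norm_minus_commute norm_triangle_sub)
      with True \<delta> have "norm x \<le> K + 1" by linarith
      then have in_S: "(s, x) \<in> ?S" "(t, y) \<in> ?S"
        using s \<delta> True by auto
      have "dist (s, x) (t, y) \<le> \<bar>s - t\<bar> + norm (y - x)"
        unfolding dist_Pair_Pair using sqrt_sum_squares_le_sum[of "dist s t" "dist x y"]
        by (simp add: dist_norm norm_minus_commute)
      also have "\<dots> < d" using s True \<delta> by linarith
      finally have "\<bar>F (s, x) - F (t, y)\<bar> \<le> e"
        using unif[OF in_S(2,1)] by (simp add: dist_real_def)
      moreover have "0 \<le> 2 * M * ((norm y)\<^sup>2 / K\<^sup>2 + (norm (y - x))\<^sup>2 / \<delta>\<^sup>2)"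
        using M by simp
      ultimately show ?thesis by linarith
    next
      case False
      have "1 \<le> (norm y)\<^sup>2 / K\<^sup>2 + (norm (y - x))\<^sup>2 / \<delta>\<^sup>2"
      proof (cases "norm y \<le> K")
        case True
        then have "\<delta> \<le> norm (y - x)" using False by simp
        then have "1 \<le> (norm (y - x))\<^sup>2 / \<delta>\<^sup>2" using \<delta> by (simp add: power_mono)
        then show ?thesis by (simp add: add_increasing)
      next
        case False
        then have "1 \<le> (norm y)\<^sup>2 / K\<^sup>2" using pos by (simp add: power_mono)
        then show ?thesis by (simp add: add_increasing2)
      qed
      then have "2 * M * 1 \<le> 2 * M * ((norm y)\<^sup>2 / K\<^sup>2 + (norm (y - x))\<^sup>2 / \<delta>\<^sup>2)"
        using M by (intro mult_left_mono) auto
      moreover have "\<bar>F (s, x) - F (t, y)\<bar> \<le> 2 * M"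
        using bound[of "(s, x)"] bound[of "(t, y)"] by linarith
      ultimately show ?thesis using pos by linarith
    qed
  qed (fact \<delta>)
qed

text \<open>Integrate the pointwise inequality against a coupling of \<open>u s\<close> and \<open>u t\<close>. The curve also moves the
  integrand, whose first argument is time.\<close>

lemma continuous_on_integral_W2_curve:
  fixes u :: "real \<Rightarrow> 'a::euclidean_space measure" and F :: "real \<times> 'a \<Rightarrow> real"
  assumes u: "\<And>t. t \<ge> 0 \<Longrightarrow> u t \<in> P2"
    and curve: "\<And>t. t \<ge> 0 \<Longrightarrow> ((\<lambda>s. W2 (u s) (u t)) \<longlongrightarrow> 0) (at t within {0..})"
    and F: "continuous_on UNIV F" "\<And>p. \<bar>F p\<bar> \<le> M"
  shows "continuous_on {0..} (\<lambda>t. LINT x|u t. F (t, x))"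
proof -
  have M: "0 \<le> M" using F(2)[of undefined] by (meson abs_ge_zero order_trans)
  have "((\<lambda>s. LINT x|u s. F (s, x)) \<longlongrightarrow> (LINT x|u t. F (t, x))) (at t within {0..})" if t: "t \<ge> 0" for t
  proof (rule tendstoI)
    fix e :: real assume "e > 0"
    define A where "A = (LINT x|u t. (norm x)\<^sup>2)"
    have A: "A \<ge> 0" unfolding A_def by (rule Bochner_Integration.integral_nonneg) simp
    \<comment> \<open>chosen such that the tail term \<open>2M A/K\<^sup>2\<close> is at most \<open>e/4\<close>; the additions of \<open>1\<close> keep \<open>K\<close>
      positive when \<open>M\<close> or \<open>A\<close> vanishes\<close>
    define K where "K = sqrt (8 * (M + 1) * (A + 1) / e)"
    have K: "K > 0" "K\<^sup>2 = 8 * (M + 1) * (A + 1) / e"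
      using M A \<open>e > 0\<close> by (auto simp: K_def)
    have KA: "2 * M * (A / K\<^sup>2) \<le> e / 4"
    proof -
      have "M * A \<le> (M + 1) * (A + 1)" using M A by (intro mult_mono) auto
      then have "A * (M * 8) \<le> (A + 1) * (M * 8 + 8)"
        by (simp add: algebra_simps)
      then show ?thesis unfolding K(2) using M A \<open>e > 0\<close>
        by (simp add: divide_le_eq pos_divide_le_eq mult_ac)
    qed
    obtain \<delta> where \<delta>: "0 < \<delta>" and osc: "\<And>s x y. \<bar>s - t\<bar> < \<delta> \<Longrightarrow>
      \<bar>F (s, x) - F (t, y)\<bar> \<le> e / 4 + 2 * M * ((norm y)\<^sup>2 / K\<^sup>2 + (norm (y - x))\<^sup>2 / \<delta>\<^sup>2)"
      using bounded_continuous_oscillation[OF F, of "e / 4" K t] \<open>e > 0\<close> K by auto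
    \<comment> \<open>chosen such that a coupling of cost below \<open>\<eta>\<^sup>2\<close> contributes at most \<open>e/4\<close>\<close>
    define \<eta> where "\<eta> = sqrt (e * \<delta>\<^sup>2 / (8 * (M + 1)))"
    have \<eta>: "\<eta> > 0" "\<eta>\<^sup>2 = e * \<delta>\<^sup>2 / (8 * (M + 1))"
      using M \<delta> \<open>e > 0\<close> by (auto simp: \<eta>_def)
    have \<eta>M: "2 * M * (\<eta>\<^sup>2 / \<delta>\<^sup>2) \<le> e / 4"
    proof -
      have "\<eta>\<^sup>2 / \<delta>\<^sup>2 = e / (8 * (M + 1))"
        unfolding \<eta>(2) using \<delta> by simp
      moreover have "2 * M * (e / (8 * (M + 1))) \<le> e / 4"
        using M \<open>e > 0\<close> by (simp add: field_simps)
      ultimately show ?thesis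
        by (simp only:)
    qed
    have "eventually (\<lambda>s. \<bar>W2 (u s) (u t)\<bar> < \<eta>) (at t within {0..})"
      using tendstoD[OF curve[OF t] \<eta>(1)] by simp
    moreover have "eventually (\<lambda>s. dist s t < \<delta>) (at t within {0..})"
      using \<delta> by (auto simp: eventually_at)
    moreover have "eventually (\<lambda>s. s \<in> {0..}) (at t within {0..})"
      by (auto simp: eventually_at_filter)
    ultimately show "eventually (\<lambda>s. dist (LINT x|u s. F (s, x)) (LINT x|u t. F (t, x)) < e) (at t within {0..})"
    proof eventually_elim
      case (elim s)
      then have us: "u s \<in> P2" and ut: "u t \<in> P2" using u t by auto
      have "W2 (u s) (u t) < \<eta>" using elim by simp
      then obtain \<pi> where \<pi>: "\<pi> \<in> couplings (u s) (u t)"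
        and cost: "(LINT z|\<pi>. (norm (snd z - fst z))\<^sup>2) < \<eta>\<^sup>2"
        using W2_less_obtain[OF couplings_nonempty[OF us ut]] by blast
      interpret \<pi>: prob_space \<pi>
        using prob_space_couplings[OF \<pi>] P2_D(1)[OF us] .
      note [measurable] = measurable_couplings[OF \<pi>] borel_measurable_continuous_onI[OF F(1)]
      have Fr: "(\<lambda>x. F (r, x)) \<in> borel_measurable borel" for r
        by (intro borel_measurable_continuous_onI continuous_on_compose2[OF F(1)])
          (auto intro: continuous_intros)
      have int: "integrable \<pi> (\<lambda>z. F (s, fst z))" "integrable \<pi> (\<lambda>z. F (t, snd z))"
        using measurable_compose[OF measurable_couplings(1)[OF \<pi>] Fr]
          measurable_compose[OF measurable_couplings(2)[OF \<pi>] Fr] F(2)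
        by (auto intro!: \<pi>.integrable_const_bound[of _ M])
      have nsq: "(\<lambda>x::'a. (norm x)\<^sup>2) \<in> borel_measurable borel" by measurable
      let ?B = "\<lambda>z. e / 4 + 2 * M * ((norm (snd z))\<^sup>2 / K\<^sup>2 + (norm (snd z - fst z))\<^sup>2 / \<delta>\<^sup>2)"
      have int_snd: "integrable \<pi> (\<lambda>z. (norm (snd z))\<^sup>2)"
        by (rule integrable_norm_snd_couplings[OF \<pi> us ut])
      have int_cost: "integrable \<pi> (\<lambda>z. (norm (snd z - fst z))\<^sup>2)"
        by (rule cost_couplings(1)[OF \<pi> us ut])
      have "(LINT x|u s. F (s, x)) - (LINT x|u t. F (t, x)) = (LINT z|\<pi>. F (s, fst z) - F (t, snd z))"
        using int by (simp add: integral_fst_couplings[OF \<pi> Fr] integral_snd_couplings[OF \<pi> Fr])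
      also have "\<bar>\<dots>\<bar> \<le> (LINT z|\<pi>. \<bar>F (s, fst z) - F (t, snd z)\<bar>)"
        by (rule integral_abs_bound)
      also have "\<dots> \<le> (LINT z|\<pi>. ?B z)"
      proof (rule integral_mono)
        show "integrable \<pi> (\<lambda>z. \<bar>F (s, fst z) - F (t, snd z)\<bar>)" using int by simp
        show "integrable \<pi> ?B" using int_snd int_cost by simp
        show "\<bar>F (s, fst z) - F (t, snd z)\<bar> \<le> ?B z" for z
          using elim by (intro osc) (simp add: dist_real_def)
      qed
      also have "\<dots> = e / 4 + 2 * M * (A / K\<^sup>2 + (LINT z|\<pi>. (norm (snd z - fst z))\<^sup>2) / \<delta>\<^sup>2)"
        using int_snd int_cost \<pi>.prob_space
        by (simp add: A_def integral_snd_couplings[OF \<pi> nsq])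
      also have "\<dots> \<le> e / 4 + 2 * M * (A / K\<^sup>2 + \<eta>\<^sup>2 / \<delta>\<^sup>2)"
        using cost M \<delta> by (intro add_left_mono mult_left_mono divide_right_mono) auto
      also have "\<dots> \<le> e / 4 + (e / 4 + e / 4)"
        using KA \<eta>M by (simp add: distrib_left)
      also have "\<dots> < e" using \<open>e > 0\<close> by simp
      finally show ?case by (simp add: dist_real_def)
    qed
  qed
  then show ?thesis by (auto simp: continuous_on)
qed

section \<open>The contraction estimate at a fixed time\<close>

text \<open>The left-hand side is at its largest for \<open>m = n\<close> when \<open>w\<close> is fixed, since \<open>\<rho>\<close> grows with \<open>m\<close> at rate
  \<open>1/2n\<close> while \<open>\<sigma> \<mapsto> \<surd>(1 - q + q\<sigma>\<^sup>2)\<close> has slope at most \<open>q\<close> for \<open>0 \<le> \<sigma> \<le> 1\<close>. For \<open>m = n\<close> put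
  \<open>a = w/4n\<close>, so \<open>\<rho> = 1 - 2a\<close>: with \<open>D = \<surd>(1 - q + q\<rho>\<^sup>2)\<close> one has \<open>(1 - D)(1 + D) = 4aq(1 - a)\<close>
  and \<open>D \<ge> 1 - 2aq\<close>, which gives \<open>1 - D \<le> 2aq(1 - a)/(1 - aq)\<close>.\<close>

lemma gaussian_profile_le:
  fixes q m n w :: real
  assumes q: "0 < q" "q < 1" and n: "0 < n" and m: "m \<le> n" and w: "0 \<le> w" "w \<le> m + n"
  defines "\<rho> \<equiv> (n + m - w) / (2 * n)"
  shows "q * m + (2 - q) * n - 2 * n * sqrt (1 - q + q * \<rho>\<^sup>2)
    \<le> w * q * ((1 - w / (4 * n)) / (1 - w * q / (4 * n)))"
proof -
  define a where "a = w / (4 * n)"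
  \<comment> \<open>the deficit of the second moment, and the value of \<open>\<rho>\<close> for \<open>m = n\<close>\<close>
  define \<delta> where "\<delta> = 1 - m / n"
  define \<rho>\<^sub>0 where "\<rho>\<^sub>0 = 1 - 2 * a"
  define D D\<^sub>0 where "D = sqrt (1 - q + q * \<rho>\<^sup>2)" and "D\<^sub>0 = sqrt (1 - q + q * \<rho>\<^sub>0\<^sup>2)"
  have a: "0 \<le> a" "a \<le> 1 / 2"
    using w m n by (auto simp: a_def field_simps)
  have \<delta>: "0 \<le> \<delta>"
    using m n by (simp add: \<delta>_def field_simps)
  have \<rho>: "\<rho> = \<rho>\<^sub>0 - \<delta> / 2"
    using n by (simp add: \<rho>_def \<rho>\<^sub>0_def a_def \<delta>_def field_simps)
  have \<rho>_nonneg: "0 \<le> \<rho>"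
    using w n by (simp add: \<rho>_def)
  have \<rho>\<^sub>0: "\<rho> \<le> \<rho>\<^sub>0" "\<rho>\<^sub>0 \<le> 1"
    using a \<delta> \<rho> by (auto simp: \<rho>\<^sub>0_def)
  have aq: "a * q \<le> 1 / 2"
    using mult_mono[of a "1/2" q 1] a q by simp
  have lower: "\<sigma> \<le> sqrt (1 - q + q * \<sigma>\<^sup>2)" if "0 \<le> \<sigma>" "\<sigma> \<le> 1" for \<sigma>
  proof (rule real_le_rsqrt)
    have "0 \<le> (1 - q) * (1 - \<sigma>\<^sup>2)"
      using q that by (simp add: power_le_one)
    then show "\<sigma>\<^sup>2 \<le> 1 - q + q * \<sigma>\<^sup>2"
      by (simp add: algebra_simps)
  qed
  have D_sq: "D\<^sup>2 = 1 - q + q * \<rho>\<^sup>2" and D\<^sub>0_sq: "D\<^sub>0\<^sup>2 = 1 - q + q * \<rho>\<^sub>0\<^sup>2"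
    using q by (auto simp: D_def D\<^sub>0_def)
  have D: "\<rho> \<le> D" "\<rho>\<^sub>0 \<le> D\<^sub>0" "0 < D" "0 < D\<^sub>0"
    using lower \<rho>_nonneg \<rho>\<^sub>0 q by (auto simp: D_def D\<^sub>0_def add_pos_nonneg)
  \<comment> \<open>passage from \<open>m\<close> to \<open>n\<close>, that is, from \<open>\<rho>\<close> to \<open>\<rho>\<^sub>0\<close>\<close>
  have step1: "2 * (D\<^sub>0 - D) \<le> q * \<delta>"
  proof -
    have "(D\<^sub>0 - D) * (D\<^sub>0 + D) = q * (\<rho>\<^sub>0 - \<rho>) * (\<rho>\<^sub>0 + \<rho>)"
      using D_sq D\<^sub>0_sq by (simp add: power2_eq_square algebra_simps)
    also have "\<dots> \<le> q * (\<rho>\<^sub>0 - \<rho>) * (D\<^sub>0 + D)"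
      using q \<rho>\<^sub>0 D by (intro mult_left_mono) auto
    finally have "D\<^sub>0 - D \<le> q * (\<rho>\<^sub>0 - \<rho>)"
      using D by (simp add: mult_le_cancel_right)
    then show ?thesis
      using \<rho> by simp
  qed
  have step2: "1 - D\<^sub>0 \<le> 2 * a * q * (1 - a) / (1 - a * q)"
  proof -
    have "0 \<le> 4 * a\<^sup>2 * q * (1 - q)"
      using q by simp
    then have "(1 - 2 * a * q)\<^sup>2 \<le> D\<^sub>0\<^sup>2"
      unfolding D\<^sub>0_sq \<rho>\<^sub>0_def by (simp add: power2_eq_square algebra_simps)
    then have "1 - 2 * a * q \<le> D\<^sub>0"
      using D(4) by (simp add: abs_le_square_iff[symmetric])
    then have "0 < 2 * (1 - a * q)" "2 * (1 - a * q) \<le> 1 + D\<^sub>0"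
      using aq by auto
    moreover have "1 - D\<^sub>0 \<ge> 0"
    proof -
      have "\<rho>\<^sub>0\<^sup>2 \<le> 1"
        using \<rho>_nonneg \<rho>\<^sub>0 by (simp add: power_le_one)
      then have "q * \<rho>\<^sub>0\<^sup>2 \<le> q * 1"
        using q by (intro mult_left_mono) auto
      then have "D\<^sub>0\<^sup>2 \<le> 1\<^sup>2"
        unfolding D\<^sub>0_sq by simp
      then show ?thesis
        using D(4) by (simp add: abs_square_le_1)
    qed
    ultimately have "(1 - D\<^sub>0) * (2 * (1 - a * q)) \<le> (1 - D\<^sub>0) * (1 + D\<^sub>0)"
      by (intro mult_left_mono)
    also have "\<dots> = 4 * a * q * (1 - a)"
      using D\<^sub>0_sq by (simp add: \<rho>\<^sub>0_def power2_eq_square algebra_simps)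
    finally show ?thesis
      using aq by (simp add: field_simps)
  qed
  have "q * m + (2 - q) * n - 2 * n * D = n * (2 * (1 - D) - q * \<delta>)"
    using n by (simp add: \<delta>_def field_simps)
  also have "\<dots> \<le> n * (2 * (1 - D\<^sub>0))"
    using n step1 by (intro mult_left_mono) auto
  also have "\<dots> \<le> n * (2 * (2 * a * q * (1 - a) / (1 - a * q)))"
    using n step2 by (intro mult_left_mono) auto
  also have "\<dots> = (4 * n * a) * q * ((1 - a) / (1 - a * q))"
    by simp
  also have "\<dots> = w * q * ((1 - w / (4 * n)) / (1 - w * q / (4 * n)))"
    using n by (simp add: a_def)
  finally show ?thesis
    by (simp add: D_def)
qed

text \<open>The weights \<open>c\<close> and \<open>s\<close> are chosen from the correlation \<open>\<rho>\<close> that an optimal coupling would have.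
  They are thus fixed before the coupling, the upper bound is affine in the cost, and it suffices to
  let the cost tend to its infimum.\<close>

lemma W2_gaussian_contraction:
  fixes \<mu> \<nu> :: "'a::euclidean_space measure" and q :: real
  assumes \<mu>: "\<mu> \<in> P2" and \<nu>: "prob_space \<nu>" "sets \<nu> = sets borel" and q: "0 < q" "q < 1"
    and charfun: "\<And>\<xi>. charfun \<nu> \<xi> = charfun \<mu> (sqrt q *\<^sub>R \<xi>) * of_real (exp (- (1 - q) * (norm \<xi>)\<^sup>2 / 2))"
    and moment: "(LINT x|\<mu>. (norm x)\<^sup>2) \<le> DIM('a)"
  defines "w \<equiv> (W2 \<mu> std_gaussian)\<^sup>2" and "n \<equiv> real DIM('a)"
  shows "(W2 \<nu> std_gaussian)\<^sup>2 \<le> w * q * ((1 - w / (4 * n)) / (1 - w * q / (4 * n)))"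
proof -
  define m where "m = (LINT x|\<mu>. (norm x)\<^sup>2)"
  define \<rho> where "\<rho> = (n + m - w) / (2 * n)"
  define D where "D = sqrt (1 - q + q * \<rho>\<^sup>2)"
  \<comment> \<open>the unit vector in the direction of \<open>(\<surd>q \<rho>, \<surd>(1 - q))\<close>, which minimises the cost\<close>
  define c s where "c = sqrt q * \<rho> / D" and "s = sqrt (1 - q) / D"
  have n: "n > 0" by (simp add: n_def)
  have w: "0 \<le> w" "w \<le> m + n"
    using W2_gaussian_le[OF \<mu>] by (auto simp: w_def m_def n_def)
  have \<rho>: "0 \<le> \<rho>" and w_eq: "w = n + m - 2 * n * \<rho>"
    using w n by (auto simp: \<rho>_def field_simps)
  have D: "D > 0" and D_sq: "D\<^sup>2 = 1 - q + q * \<rho>\<^sup>2"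
    using q by (auto simp: D_def add_pos_nonneg)
  have c: "0 \<le> c" and c_sq: "c\<^sup>2 = q * \<rho>\<^sup>2 / D\<^sup>2" and s_sq: "s\<^sup>2 = (1 - q) / D\<^sup>2"
    using \<rho> D q by (auto simp: c_def s_def power_divide power_mult_distrib)
  have cs: "c\<^sup>2 + s\<^sup>2 = 1"
  proof -
    have "c\<^sup>2 + s\<^sup>2 = D\<^sup>2 / D\<^sup>2"
      unfolding c_sq s_sq add_divide_distrib[symmetric] D_sq by (simp add: add.commute)
    then show ?thesis using D by simp
  qed
  define K where "K = q * m + c\<^sup>2 * n - sqrt q * c * (m + n) + (s - sqrt (1 - q))\<^sup>2 * n"
  have bound: "(W2 \<nu> std_gaussian)\<^sup>2 \<le> K + sqrt q * c * (LINT z|\<pi>. (norm (snd z - fst z))\<^sup>2)"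
    if "\<pi> \<in> couplings \<mu> std_gaussian" for \<pi>
    using W2_gaussian_correlated_coupling[OF \<mu> \<nu> _ that cs, of "sqrt q" "sqrt (1 - q)"] charfun q
    by (simp add: K_def m_def n_def algebra_simps)
  have "(W2 \<nu> std_gaussian)\<^sup>2 \<le> K + sqrt q * c * w"
  proof (rule field_le_epsilon)
    fix e :: real assume e: "e > 0"
    define k where "k = sqrt q * c"
    have k: "k \<ge> 0" using c q by (simp add: k_def)
    have "w < w + e / (k + 1)" using e k by simp
    then obtain \<pi> where \<pi>: "\<pi> \<in> couplings \<mu> std_gaussian"
      "(LINT z|\<pi>. (norm (snd z - fst z))\<^sup>2) < w + e / (k + 1)"
      unfolding w_def using W2_power2_approx[OF couplings_nonempty[OF \<mu> std_gaussian_in_P2]] by blast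
    have "(W2 \<nu> std_gaussian)\<^sup>2 \<le> K + k * (w + e / (k + 1))"
      using bound[OF \<pi>(1)] mult_left_mono[OF less_imp_le[OF \<pi>(2)] k] by (simp add: k_def)
    also have "\<dots> = K + k * w + k * (e / (k + 1))"
      by (simp only: distrib_left add.assoc)
    also have "k * (e / (k + 1)) \<le> e"
      using k e by (simp add: field_simps)
    finally show "(W2 \<nu> std_gaussian)\<^sup>2 \<le> K + sqrt q * c * w + e"
      by (simp add: k_def)
  qed
  also have "K + sqrt q * c * w = q * m + (2 - q) * n - 2 * n * D"
  proof -
    have "K + sqrt q * c * w = q * m + (c\<^sup>2 + s\<^sup>2) * n + (sqrt (1 - q))\<^sup>2 * n
        - 2 * n * (sqrt q * c * \<rho> + sqrt (1 - q) * s)"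
      unfolding K_def w_eq by (simp add: power2_diff algebra_simps)
    also have "sqrt q * c * \<rho> + sqrt (1 - q) * s = D"
    proof -
      have "sqrt q * c * \<rho> + sqrt (1 - q) * s = D\<^sup>2 / D"
        unfolding c_def s_def D_sq using q by (simp add: add_divide_distrib power2_eq_square add.commute)
      then show ?thesis using D by (simp add: power2_eq_square)
    qed
    finally show ?thesis
      using q cs by (simp add: algebra_simps)
  qed
  also have "\<dots> \<le> w * q * ((1 - w / (4 * n)) / (1 - w * q / (4 * n)))"
    unfolding D_def \<rho>_def using moment
    by (intro gaussian_profile_le q n w) (simp add: m_def n_def)
  finally show ?thesis .
qed

section \<open>The adjoint operator on truncated exponentials\<close>

text \<open>Directional derivatives become derivatives in one real variable, once differentiability is known
  from the calculus of \<open>C\<^sup>k\<close> functions.\<close>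

lemma dir_deriv_eqI:
  assumes "f differentiable (at z)"
    and "((\<lambda>s. f (z + s *\<^sub>R v)) has_real_derivative d) (at 0)"
  shows "dir_deriv v f z = d"
proof -
  have "((\<lambda>s. f (z + s *\<^sub>R v)) has_derivative (\<lambda>s. dir_deriv (s *\<^sub>R v) f z)) (at 0)"
  proof (rule has_derivative_compose[where f = "\<lambda>s. z + s *\<^sub>R v"])
    show "((\<lambda>s. z + s *\<^sub>R v) has_derivative (\<lambda>s. s *\<^sub>R v)) (at 0)"
      by (auto intro!: derivative_eq_intros)
    show "(f has_derivative frechet_derivative f (at z)) (at (z + 0 *\<^sub>R v))"
      using assms(1) by (simp add: frechet_derivative_works)
  qed
  from has_derivative_unique[OF this assms(2)[unfolded has_field_derivative_def]]
  show ?thesis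
    by (auto dest!: fun_cong[where x = 1])
qed

lemma C_k_norm_snd: "C_k k (\<lambda>z :: real \<times> 'a::euclidean_space. (norm (snd z))\<^sup>2)"
proof -
  have "C_k k (\<lambda>z :: real \<times> 'a. \<Sum>b\<in>Basis. (snd z \<bullet> b) * (snd z \<bullet> b))"
    by (intro C_k_sum C_k_mult C_k_bounded_linear bounded_linear_inner_left_comp bounded_linear_snd)
  then show ?thesis
    unfolding norm_power2_Basis unfolding power2_eq_square .
qed

lemma norm_power2_add_scaleR:
  "(norm (x + s *\<^sub>R w))\<^sup>2 = (norm x)\<^sup>2 + 2 * s * (x \<bullet> w) + s\<^sup>2 * (norm w)\<^sup>2"
  for x w :: "'a::real_inner"
  using norm_power2_expand[of 1 x s w] by simp

text \<open>The exact solution \<open>exp(e\<^sup>2\<^sup>t|\<xi>|\<^sup>2/2) cos(e\<^sup>t \<xi>\<sqdot>x - \<theta>)\<close> of the adjoint equation, cut off in time by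
  \<open>\<kappa>\<close> and in space by \<open>B(1 - l|x|\<^sup>2)\<close>. The phase \<open>\<theta>\<close> treats cosine and sine at once.\<close>

definition truncated_wave ::
    "(real \<Rightarrow> real) \<Rightarrow> (real \<Rightarrow> real) \<Rightarrow> real \<Rightarrow> 'a::euclidean_space \<Rightarrow> real \<Rightarrow> real \<times> 'a \<Rightarrow> real" where
  "truncated_wave \<kappa> B l \<xi> \<theta> z = \<kappa> (fst z) * B (1 - l * (norm (snd z))\<^sup>2)
    * (exp (exp (2 * fst z) * ((norm \<xi>)\<^sup>2 / 2)) * cos (exp (fst z) * (\<xi> \<bullet> snd z) - \<theta>))"

lemma C_k_truncated_wave:
  assumes "\<And>k. C_k k \<kappa>" "\<And>k. C_k k B"
  shows "C_k k (truncated_wave \<kappa> B l \<xi> \<theta>)"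
  unfolding truncated_wave_def
  by (intro C_k_mult C_k_diff C_k_const C_k_norm_snd C_k_compose[OF assms(1)] C_k_compose[OF assms(2)]
    C_k_compose[OF C_k_exp] C_k_compose[OF C_k_cos] C_k_bounded_linear
    bounded_linear_fst bounded_linear_inner_right_comp bounded_linear_snd)

lemma truncated_wave_test_function:
  fixes \<xi> :: "'a::euclidean_space"
  assumes C: "\<And>k. C_k k \<kappa>" "\<And>k. C_k k B" and \<kappa>: "0 < a" "\<And>t. t \<notin> {a..b} \<Longrightarrow> \<kappa> t = 0"
    and B: "\<And>r. r \<le> 0 \<Longrightarrow> B r = 0" and l: "0 < l" "l \<le> 1"
  shows "truncated_wave \<kappa> B l \<xi> \<theta> \<in> test_functions ({0<..} \<times> UNIV)"
proof -
  let ?K = "{a..b} \<times> cball (0 :: 'a) (1 / l)"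
  have supp: "{z. truncated_wave \<kappa> B l \<xi> \<theta> z \<noteq> 0} \<subseteq> ?K"
  proof
    fix z :: "real \<times> 'a" assume "z \<in> {z. truncated_wave \<kappa> B l \<xi> \<theta> z \<noteq> 0}"
    then have z: "\<kappa> (fst z) \<noteq> 0" "B (1 - l * (norm (snd z))\<^sup>2) \<noteq> 0"
      by (auto simp: truncated_wave_def)
    have "fst z \<in> {a..b}" using z(1) \<kappa>(2) by blast
    moreover have "norm (snd z) \<le> 1 / l"
    proof (rule ccontr)
      assume "\<not> norm (snd z) \<le> 1 / l"
      then have n: "1 < l * norm (snd z)" using l by (simp add: field_simps)
      have "l * norm (snd z) \<le> norm (snd z)" using l by (simp add: mult_left_le_one_le)
      then have "1 * 1 \<le> (l * norm (snd z)) * norm (snd z)"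
        using n by (intro mult_mono) auto
      then have "B (1 - l * (norm (snd z))\<^sup>2) = 0"
        by (intro B) (simp add: power2_eq_square mult.assoc)
      with z(2) show False by simp
    qed
    ultimately show "z \<in> ?K" by (cases z) auto
  qed
  have "compact ?K" by (intro compact_Times) auto
  moreover have "closure {z. truncated_wave \<kappa> B l \<xi> \<theta> z \<noteq> 0} \<subseteq> ?K"
    using supp \<open>compact ?K\<close> by (intro closure_minimal compact_imp_closed)
  moreover have "?K \<subseteq> {0<..} \<times> UNIV"
    using \<kappa>(1) by auto
  moreover have "compact (closure {z. truncated_wave \<kappa> B l \<xi> \<theta> z \<noteq> 0})"
    using bounded_subset[OF compact_imp_bounded[OF \<open>compact ?K\<close>] supp] by simp
  ultimately show ?thesis
    unfolding test_functions_def using C_k_truncated_wave[OF C] by blast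
qed

text \<open>What the adjoint operator makes of a truncated wave. The first summand is the main term. All others
  carry a derivative of the spatial cutoff, hence a factor \<open>l\<close>. The products \<open>l|x|\<^sup>2\<close> and \<open>l(x\<sqdot>\<xi>)\<close> are
  kept together since they are bounded on the support of the cutoff. The parameters \<open>\<kappa>'\<close>, \<open>B'\<close> and
  \<open>B''\<close> stand for derivatives.\<close>

definition wave_adjoint ::
    "(real \<Rightarrow> real) \<Rightarrow> (real \<Rightarrow> real) \<Rightarrow> (real \<Rightarrow> real) \<Rightarrow> (real \<Rightarrow> real) \<Rightarrow> (real \<Rightarrow> real) \<Rightarrow>
     'a::euclidean_space \<Rightarrow> real \<Rightarrow> real \<Rightarrow> real \<times> 'a \<Rightarrow> real" where
  "wave_adjoint \<kappa> \<kappa>' B B' B'' \<xi> \<theta> l z =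
    (let t = fst z; x = snd z; E = exp (exp (2 * t) * ((norm \<xi>)\<^sup>2 / 2));
         \<alpha> = exp t * (\<xi> \<bullet> x) - \<theta>; \<beta> = 1 - l * (norm x)\<^sup>2
     in \<kappa>' t * B \<beta> * (E * cos \<alpha>)
      + \<kappa> t * E * (B' \<beta> * ((2 * (l * (norm x)\<^sup>2) - 2 * l * DIM('a)) * cos \<alpha>
            + 4 * exp t * (l * (x \<bullet> \<xi>)) * sin \<alpha>)
          + B'' \<beta> * (4 * (l * (l * (norm x)\<^sup>2))) * cos \<alpha>))"

lemma fokker_planck_adjoint_truncated_wave:
  fixes \<xi> x :: "'a::euclidean_space" and \<theta> l :: real and \<kappa> \<kappa>' B B' B'' :: "real \<Rightarrow> real"
  assumes C: "\<And>k. C_k k \<kappa>" "\<And>k. C_k k B"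
    and \<kappa>: "\<And>t. (\<kappa> has_real_derivative \<kappa>' t) (at t)"
    and B: "\<And>r. (B has_real_derivative B' r) (at r)" "\<And>r. (B' has_real_derivative B'' r) (at r)"
  shows "fokker_planck_adjoint (truncated_wave \<kappa> B l \<xi> \<theta>) t x =
    wave_adjoint \<kappa> \<kappa>' B B' B'' \<xi> \<theta> l (t, x)"
proof -
  let ?\<phi> = "truncated_wave \<kappa> B l \<xi> \<theta>"
  define E where "E t = exp (exp (2 * t) * ((norm \<xi>)\<^sup>2 / 2))" for t
  define \<alpha> where "\<alpha> t x = exp t * (\<xi> \<bullet> x) - \<theta>" for t x
  define \<beta> where "\<beta> x = 1 - l * (norm x)\<^sup>2" for x :: 'a
  \<comment> \<open>the spatial derivative of the wave in direction \<open>w\<close>\<close>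
  define G where "G w z = \<kappa> (fst z) * E (fst z) * (B' (\<beta> (snd z)) * (- 2 * l * (snd z \<bullet> w)) * cos (\<alpha> (fst z) (snd z))
      - B (\<beta> (snd z)) * exp (fst z) * (\<xi> \<bullet> w) * sin (\<alpha> (fst z) (snd z)))" for w :: 'a and z
  have diff: "?\<phi> differentiable (at z)" for z
    using C_k_SucD(1)[OF C_k_truncated_wave[OF C]] unfolding differentiable_def by blast
  have diff2: "dir_deriv v ?\<phi> differentiable (at z)" for v z
    using C_k_SucD(1)[OF C_k_SucD(2)[OF C_k_truncated_wave[OF C]]] unfolding differentiable_def by blast
  have wave: "?\<phi> (t, x) = \<kappa> t * B (\<beta> x) * (E t * cos (\<alpha> t x))" for t x
    by (simp add: truncated_wave_def E_def \<alpha>_def \<beta>_def)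
  have d\<beta>: "((\<lambda>s. f (\<beta> (x + s *\<^sub>R w))) has_real_derivative f' (\<beta> x) * (- 2 * l * (x \<bullet> w))) (at 0)"
    if "\<And>r. (f has_real_derivative f' r) (at r)" for f f' :: "real \<Rightarrow> real" and x w
  proof -
    have 1: "((\<lambda>s. \<beta> (x + s *\<^sub>R w)) has_real_derivative - 2 * l * (x \<bullet> w)) (at 0)"
      unfolding \<beta>_def norm_power2_add_scaleR by (auto intro!: derivative_eq_intros)
    have 2: "(f has_real_derivative f' (\<beta> x)) (at (\<beta> (x + 0 *\<^sub>R w)))"
      using that by simp
    show ?thesis by (rule DERIV_chain2[OF 2 1])
  qed
  have d\<alpha>: "((\<lambda>s. \<alpha> t (x + s *\<^sub>R w)) has_real_derivative exp t * (\<xi> \<bullet> w)) (at 0)" for t x w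
    unfolding \<alpha>_def inner_add_right inner_scaleR_right by (auto intro!: derivative_eq_intros)
  have time: "dir_deriv (1, 0) ?\<phi> (t, x) = \<kappa>' t * B (\<beta> x) * (E t * cos (\<alpha> t x))
      + \<kappa> t * B (\<beta> x) * (exp (2 * t) * (norm \<xi>)\<^sup>2 * E t * cos (\<alpha> t x) - E t * sin (\<alpha> t x) * exp t * (\<xi> \<bullet> x))"
    (is "_ = ?d")
  proof (rule dir_deriv_eqI[OF diff])
    have d1: "((\<lambda>s. \<kappa> (t + s)) has_real_derivative \<kappa>' t) (at 0)"
      using DERIV_shift[of \<kappa> "\<kappa>' t" 0 t] \<kappa>[of t] by (simp add: add.commute)
    have d2: "((\<lambda>s. E (t + s)) has_real_derivative exp (2 * t) * (norm \<xi>)\<^sup>2 * E t) (at 0)"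
      unfolding E_def by (auto intro!: derivative_eq_intros)
    have d3: "((\<lambda>s. \<alpha> (t + s) x) has_real_derivative exp t * (\<xi> \<bullet> x)) (at 0)"
      unfolding \<alpha>_def by (auto intro!: derivative_eq_intros)
    have "((\<lambda>s. \<kappa> (t + s) * B (\<beta> x) * (E (t + s) * cos (\<alpha> (t + s) x))) has_real_derivative ?d) (at 0)"
      by (rule derivative_eq_intros d1 d2 d3 refl)+ (simp add: algebra_simps)
    then show "((\<lambda>s. ?\<phi> ((t, x) + s *\<^sub>R (1, 0))) has_real_derivative ?d) (at 0)"
      by (simp add: wave)
  qed
  have space: "dir_deriv (0, w) ?\<phi> z = G w z" for w z
  proof (rule dir_deriv_eqI[OF diff])
    have "((\<lambda>s. \<kappa> (fst z) * B (\<beta> (snd z + s *\<^sub>R w)) * (E (fst z) * cos (\<alpha> (fst z) (snd z + s *\<^sub>R w))))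
        has_real_derivative G w z) (at 0)"
      unfolding G_def by (auto intro!: derivative_eq_intros d\<beta>[OF B(1)] d\<alpha> simp: algebra_simps)
    then show "((\<lambda>s. ?\<phi> (z + s *\<^sub>R (0, w))) has_real_derivative G w z) (at 0)"
      by (cases z) (simp add: wave)
  qed
  have space2: "dir_deriv (0, b) (dir_deriv (0, b) ?\<phi>) (t, x) = \<kappa> t * E t *
      (B'' (\<beta> x) * (4 * l * l * (x \<bullet> b)\<^sup>2) * cos (\<alpha> t x) - B' (\<beta> x) * (2 * l) * cos (\<alpha> t x)
       + 4 * B' (\<beta> x) * l * exp t * sin (\<alpha> t x) * ((x \<bullet> b) * (\<xi> \<bullet> b))
       - B (\<beta> x) * cos (\<alpha> t x) * exp (2 * t) * (\<xi> \<bullet> b)\<^sup>2)" (is "_ = ?d") if "b \<in> Basis" for b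
  proof (rule dir_deriv_eqI[OF diff2])
    have bb: "b \<bullet> b = 1" using that by simp
    have ee: "exp (t * 2) = exp t * exp t" by (simp add: exp_add[symmetric])
    have d4: "((\<lambda>s. (x + s *\<^sub>R b) \<bullet> b) has_real_derivative 1) (at 0)"
      unfolding inner_add_left inner_scaleR_left bb by (auto intro!: derivative_eq_intros)
    have "((\<lambda>s. \<kappa> t * E t * (B' (\<beta> (x + s *\<^sub>R b)) * (- 2 * l * ((x + s *\<^sub>R b) \<bullet> b)) * cos (\<alpha> t (x + s *\<^sub>R b))
        - B (\<beta> (x + s *\<^sub>R b)) * exp t * (\<xi> \<bullet> b) * sin (\<alpha> t (x + s *\<^sub>R b))))
        has_real_derivative ?d) (at 0)"
      by (rule derivative_eq_intros d\<beta>[OF B(1)] d\<beta>[OF B(2)] d\<alpha> d4 refl)+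
        (simp add: ee power2_eq_square algebra_simps)
    then show "((\<lambda>s. dir_deriv (0, b) ?\<phi> ((t, x) + s *\<^sub>R (0, b))) has_real_derivative ?d) (at 0)"
      unfolding space G_def by simp
  qed
  have inner_sum: "(\<Sum>b\<in>Basis. (x \<bullet> b) * (\<xi> \<bullet> b)) = x \<bullet> \<xi>"
    by (rule euclidean_inner[symmetric])
  have "(\<Sum>b\<in>Basis. dir_deriv (0, b) (dir_deriv (0, b) ?\<phi>) (t, x)) = \<kappa> t * E t *
      (B'' (\<beta> x) * (4 * l * l * (norm x)\<^sup>2) * cos (\<alpha> t x) - DIM('a) * (B' (\<beta> x) * (2 * l) * cos (\<alpha> t x))
       + 4 * B' (\<beta> x) * l * exp t * sin (\<alpha> t x) * (x \<bullet> \<xi>)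
       - B (\<beta> x) * cos (\<alpha> t x) * exp (2 * t) * (norm \<xi>)\<^sup>2)"
    by (simp add: space2 sum.distrib sum_subtractf norm_power2_Basis inner_sum[symmetric]
      sum_distrib_left[symmetric] sum_distrib_right[symmetric])
  then have "fokker_planck_adjoint ?\<phi> t x =
      \<kappa>' t * B (\<beta> x) * (E t * cos (\<alpha> t x))
      + \<kappa> t * E t * (B' (\<beta> x) * ((2 * (l * (norm x)\<^sup>2) - 2 * l * DIM('a)) * cos (\<alpha> t x)
            + 4 * exp t * (l * (x \<bullet> \<xi>)) * sin (\<alpha> t x))
          + B'' (\<beta> x) * (4 * (l * (l * (norm x)\<^sup>2))) * cos (\<alpha> t x))"
    unfolding fokker_planck_adjoint_def time space
    by (simp add: G_def power2_norm_eq_inner inner_commute algebra_simps)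
  then show ?thesis
    unfolding wave_adjoint_def Let_def fst_conv snd_conv E_def \<alpha>_def \<beta>_def .
qed

text \<open>Continuity in \<open>(t, x)\<close> yields measurability of the integrals over \<open>x\<close> as functions of time; continuity
  in \<open>l\<close>, down to \<open>l = 0\<close>, yields the pointwise limit in which the cutoff disappears.\<close>

lemma wave_adjoint_continuous:
  assumes "continuous_on UNIV \<kappa>" "continuous_on UNIV \<kappa>'" "continuous_on UNIV B" "continuous_on UNIV B'" "continuous_on UNIV B''"
  shows "continuous_on UNIV (\<lambda>z. wave_adjoint \<kappa> \<kappa>' B B' B'' \<xi> \<theta> l z)"
    and "continuous_on UNIV (\<lambda>l. wave_adjoint \<kappa> \<kappa>' B B' B'' \<xi> \<theta> l z)"
  unfolding wave_adjoint_def Let_def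
  by (intro continuous_intros continuous_on_compose2[OF assms(1)] continuous_on_compose2[OF assms(2)]
    continuous_on_compose2[OF assms(3)] continuous_on_compose2[OF assms(4)] continuous_on_compose2[OF assms(5)]
    subset_UNIV)+

text \<open>On the support of the cutoff \<open>l|x|\<^sup>2 \<le> 1\<close>, and therefore \<open>l|x| \<le> 1\<close> because \<open>l \<le> 1\<close>. The bound does
  not depend on \<open>l\<close>, which permits dominated convergence as \<open>l\<close> tends to \<open>0\<close>.\<close>

lemma wave_adjoint_bounded:
  fixes \<xi> :: "'a::euclidean_space"
  assumes \<kappa>: "\<And>t. \<bar>\<kappa> t\<bar> \<le> c" "\<And>t. \<bar>\<kappa>' t\<bar> \<le> c" "\<And>t. t \<notin> {a..b} \<Longrightarrow> \<kappa> t = 0 \<and> \<kappa>' t = 0"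
    and B: "\<And>r. r \<le> 0 \<Longrightarrow> B r = 0 \<and> B' r = 0 \<and> B'' r = 0"
    "\<And>r. r \<le> 1 \<Longrightarrow> \<bar>B r\<bar> \<le> C \<and> \<bar>B' r\<bar> \<le> C \<and> \<bar>B'' r\<bar> \<le> C"
    and l: "0 < l" "l \<le> 1"
  defines "E \<equiv> exp (exp (2 * b) * ((norm \<xi>)\<^sup>2 / 2))"
  shows "\<bar>wave_adjoint \<kappa> \<kappa>' B B' B'' \<xi> \<theta> l (t, x)\<bar>
    \<le> c * E * (C * (1 + (2 + 2 * DIM('a) + 4 * exp b * norm \<xi>) + 4)) * indicator {a..b} t"
proof (cases "t \<in> {a..b} \<and> l * (norm x)\<^sup>2 < 1")
  case False
  have "0 \<le> c" using \<kappa>(1)[of 0] by linarith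
  moreover have "0 \<le> C" using B(2)[of 0] by linarith
  ultimately have "0 \<le> c * E * (C * (1 + (2 + 2 * DIM('a) + 4 * exp b * norm \<xi>) + 4)) * indicator {a..b} t"
    by (simp add: E_def)
  moreover have "wave_adjoint \<kappa> \<kappa>' B B' B'' \<xi> \<theta> l (t, x) = 0"
    using False \<kappa>(3)[of t] B(1)[of "1 - l * (norm x)\<^sup>2"] by (auto simp: wave_adjoint_def Let_def)
  ultimately show ?thesis by simp
next
  case True
  have c: "0 \<le> c" using \<kappa>(1)[of 0] by linarith
  have C: "0 \<le> C" using B(2)[of 0] by linarith
  define Et where "Et = exp (exp (2 * t) * ((norm \<xi>)\<^sup>2 / 2))"
  define \<alpha> where "\<alpha> = exp t * (\<xi> \<bullet> x) - \<theta>"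
  define \<beta> where "\<beta> = 1 - l * (norm x)\<^sup>2"
  define p where "p = 2 * (l * (norm x)\<^sup>2) - 2 * l * DIM('a)"
  define s where "s = 4 * exp t * (l * (x \<bullet> \<xi>))"
  define r where "r = 4 * (l * (l * (norm x)\<^sup>2))"
  have Et: "0 \<le> Et" "Et \<le> E"
    using True by (auto simp: Et_def E_def intro!: mult_right_mono)
  have "\<beta> \<le> 1" using l by (simp add: \<beta>_def)
  note B\<beta> = B(2)[OF this]
  have y: "0 \<le> l * (norm x)\<^sup>2" "l * (norm x)\<^sup>2 \<le> 1" using True l by auto
  have "0 \<le> l * DIM('a)" "l * DIM('a) \<le> DIM('a)"
    using l by (auto intro: mult_left_le_one_le)
  then have p: "\<bar>p\<bar> \<le> 2 + 2 * DIM('a)"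
    unfolding p_def using y by (intro abs_leI) linarith+
  have r: "\<bar>r\<bar> \<le> 4"
    using mult_mono[of l 1 "l * (norm x)\<^sup>2" 1] y l by (simp add: r_def)
  have "(l * norm x)\<^sup>2 \<le> 1"
    using mult_mono[of l 1 "l * (norm x)\<^sup>2" 1] y l by (simp add: power2_eq_square mult_ac)
  then have "l * norm x \<le> 1"
    using l by (simp add: abs_square_le_1)
  then have "l * norm x * norm \<xi> \<le> 1 * norm \<xi>"
    by (intro mult_right_mono) auto
  moreover have "\<bar>l * (x \<bullet> \<xi>)\<bar> \<le> l * norm x * norm \<xi>"
    using Cauchy_Schwarz_ineq2[of x \<xi>] l by (simp add: abs_mult mult.assoc mult_left_mono)
  ultimately have "\<bar>l * (x \<bullet> \<xi>)\<bar> \<le> norm \<xi>" by simp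
  then have s: "\<bar>s\<bar> \<le> 4 * exp b * norm \<xi>"
    unfolding s_def abs_mult[of "4 * exp t"] using True by (intro mult_mono) auto
  have prod: "\<bar>v * w\<bar> \<le> V * W" if "\<bar>v\<bar> \<le> V" "\<bar>w\<bar> \<le> W" for v w V W :: real
    unfolding abs_mult using that by (intro mult_mono) auto
  have trig: "\<bar>v * cos \<alpha>\<bar> \<le> V" "\<bar>v * sin \<alpha>\<bar> \<le> V" if "\<bar>v\<bar> \<le> V" for v V :: real
    using prod[OF that abs_cos_le_one] prod[OF that abs_sin_le_one] by auto
  have "\<bar>\<kappa>' t * B \<beta> * (Et * cos \<alpha>)\<bar> \<le> c * C * E"
    using B\<beta> Et by (intro prod trig \<kappa>) auto
  moreover have "\<bar>\<kappa> t * Et * (B' \<beta> * (p * cos \<alpha> + s * sin \<alpha>) + B'' \<beta> * r * cos \<alpha>)\<bar>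
      \<le> c * E * (C * ((2 + 2 * DIM('a)) + 4 * exp b * norm \<xi>) + C * 4)"
    using B\<beta> Et p r s
    by (intro prod \<kappa> order_trans[OF abs_triangle_ineq] add_mono trig) auto
  moreover have "wave_adjoint \<kappa> \<kappa>' B B' B'' \<xi> \<theta> l (t, x) = \<kappa>' t * B \<beta> * (Et * cos \<alpha>)
      + \<kappa> t * Et * (B' \<beta> * (p * cos \<alpha> + s * sin \<alpha>) + B'' \<beta> * r * cos \<alpha>)"
    by (simp add: wave_adjoint_def Let_def Et_def \<alpha>_def \<beta>_def p_def s_def r_def)
  ultimately have "\<bar>wave_adjoint \<kappa> \<kappa>' B B' B'' \<xi> \<theta> l (t, x)\<bar>
      \<le> c * C * E + c * E * (C * ((2 + 2 * DIM('a)) + 4 * exp b * norm \<xi>) + C * 4)"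
    by linarith
  then show ?thesis
    using True by (simp add: algebra_simps)
qed

section \<open>The law at time t\<close>

text \<open>Test the equation with truncated waves and let \<open>l\<close> tend to \<open>0\<close>, first inside the integral over
  \<open>x\<close> and then inside the integral over \<open>t\<close>. Only the derivative of the cutoff in time survives, with
  the factor \<open>B 1\<close>.\<close>

lemma fokker_planck_wave_weak:
  fixes u :: "real \<Rightarrow> 'a::euclidean_space measure" and \<xi> :: 'a
  assumes u: "\<And>t. t \<ge> 0 \<Longrightarrow> u t \<in> P2"
    and curve: "\<And>t. t \<ge> 0 \<Longrightarrow> ((\<lambda>s. W2 (u s) (u t)) \<longlongrightarrow> 0) (at t within {0..})"
    and FP: "fokker_planck_solution u"
    and \<kappa>: "0 < a" "\<And>k. C_k k \<kappa>" "\<And>k. C_k k \<kappa>'" "\<And>t. (\<kappa> has_real_derivative \<kappa>' t) (at t)"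
    "\<And>t. t \<notin> {a..b} \<Longrightarrow> \<kappa> t = 0" "\<And>t. t \<notin> {a..b} \<Longrightarrow> \<kappa>' t = 0"
  shows "(LINT t:{0<..}|lborel. \<kappa>' t * (exp (exp (2 * t) * ((norm \<xi>)\<^sup>2 / 2))
    * (LINT x|u t. cos (exp t * (\<xi> \<bullet> x) - \<theta>)))) = 0"
proof -
  obtain B B' B'' :: "real \<Rightarrow> real" and C :: real
    where B_smooth: "\<And>k. C_k k B" "\<And>k. C_k k B'" "\<And>k. C_k k B''"
    and B_deriv: "\<And>r. (B has_real_derivative B' r) (at r)" "\<And>r. (B' has_real_derivative B'' r) (at r)"
    and B_zero: "\<And>r. r \<le> 0 \<Longrightarrow> B r = 0 \<and> B' r = 0 \<and> B'' r = 0"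
    and B_bound: "\<And>r. r \<le> 1 \<Longrightarrow> \<bar>B r\<bar> \<le> C \<and> \<bar>B' r\<bar> \<le> C \<and> \<bar>B'' r\<bar> \<le> C"
    and B1: "B 1 \<noteq> 0"
    using bump_exists by metis
  note cont = C_k_continuous[OF \<kappa>(2)[of 0]] C_k_continuous[OF \<kappa>(3)[of 0]]
    C_k_continuous[OF B_smooth(1)[of 0]] C_k_continuous[OF B_smooth(2)[of 0]] C_k_continuous[OF B_smooth(3)[of 0]]
  have "bounded (\<kappa> ` {a..b} \<union> \<kappa>' ` {a..b})"
    by (intro bounded_Un[THEN iffD2] conjI compact_imp_bounded compact_continuous_image
      continuous_on_subset[OF cont(1)] continuous_on_subset[OF cont(2)]) auto
  then obtain c0 where c0: "\<And>t. t \<in> {a..b} \<Longrightarrow> \<bar>\<kappa> t\<bar> \<le> c0 \<and> \<bar>\<kappa>' t\<bar> \<le> c0"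
    unfolding bounded_iff by (metis UnI1 UnI2 imageI real_norm_def)
  define c where "c = max c0 0"
  have c: "\<bar>\<kappa> t\<bar> \<le> c" "\<bar>\<kappa>' t\<bar> \<le> c" for t
    using c0[of t] \<kappa>(5,6)[of t] by (cases "t \<in> {a..b}"; simp add: c_def le_max_iff_disj)+
  \<comment> \<open>at \<open>l = 0\<close> this is the wave without cutoff, multiplied by \<open>\<kappa>' t\<close> and \<open>B 1\<close>\<close>
  define L where "L l z = wave_adjoint \<kappa> \<kappa>' B B' B'' \<xi> \<theta> l z" for l z
  define W where "W = c * exp (exp (2 * b) * ((norm \<xi>)\<^sup>2 / 2)) * (C * (1 + (2 + 2 * DIM('a) + 4 * exp b * norm \<xi>) + 4))"
  have L_cont: "continuous_on UNIV (L l)" "continuous_on UNIV (\<lambda>l. L l z)" for l z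
    unfolding L_def by (rule wave_adjoint_continuous[OF cont])+
  have L_bound: "\<bar>L l (t, x)\<bar> \<le> W * indicator {a..b} t" if "0 < l" "l \<le> 1" for l t x
    unfolding L_def W_def
    by (rule wave_adjoint_bounded) (use c \<kappa>(5,6) B_zero B_bound that in auto)
  have "0 \<le> C" using B_bound[of 0] by linarith
  then have W: "0 \<le> W" by (simp add: W_def c_def)
  have L_bound': "\<bar>L l z\<bar> \<le> W" if "0 < l" "l \<le> 1" for l z
    using L_bound[OF that, of "fst z" "snd z"] W by (cases "fst z \<in> {a..b}") simp_all
  have L_meas: "(\<lambda>x. L l (t, x)) \<in> borel_measurable borel" for l t
    by (intro borel_measurable_continuous_onI continuous_on_compose2[OF L_cont(1)])
      (auto intro: continuous_intros)
  have weak: "(LINT t:{0<..}|lborel. (LINT x|u t. L l (t, x))) = 0" if "0 < l" "l \<le> 1" for l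
  proof -
    have "truncated_wave \<kappa> B l \<xi> \<theta> \<in> test_functions ({0<..} \<times> UNIV)"
      by (rule truncated_wave_test_function) (use \<kappa> B_smooth B_zero that in auto)
    then have "(LINT t:{0<..}|lborel. (LINT x|u t. fokker_planck_adjoint (truncated_wave \<kappa> B l \<xi> \<theta>) t x)) = 0"
      using FP unfolding fokker_planck_solution_def by blast
    moreover have "fokker_planck_adjoint (truncated_wave \<kappa> B l \<xi> \<theta>) t x = L l (t, x)" for t x
      unfolding L_def
      by (rule fokker_planck_adjoint_truncated_wave[OF \<kappa>(2) B_smooth(1) \<kappa>(4) B_deriv])
    ultimately show ?thesis
      by (simp only:)
  qed
  define l :: "nat \<Rightarrow> real" where "l k = 1 / real (Suc k)" for k
  have l: "0 < l k" "l k \<le> 1" for k by (auto simp: l_def)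
  have l_lim: "l \<longlonglongrightarrow> 0" unfolding l_def by (rule LIMSEQ_Suc[OF lim_1_over_n])
  have inner: "(\<lambda>k. LINT x|u t. L (l k) (t, x)) \<longlonglongrightarrow> (LINT x|u t. L 0 (t, x))"
    and inner_bound: "\<bar>LINT x|u t. L (l k) (t, x)\<bar> \<le> W * indicator {a..b} t" if "t \<ge> 0" for t k
  proof -
    note ut = P2_D[OF u[OF that]]
    interpret prob_space "u t" by (rule ut(1))
    have meas: "(\<lambda>x. L l (t, x)) \<in> borel_measurable (u t)" for l
      using L_meas measurable_cong_sets[OF ut(2) refl] by blast
    show "(\<lambda>k. LINT x|u t. L (l k) (t, x)) \<longlonglongrightarrow> (LINT x|u t. L 0 (t, x))"
    proof (rule integral_dominated_convergence[where w = "\<lambda>_. W"])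
      show "AE x in u t. (\<lambda>k. L (l k) (t, x)) \<longlonglongrightarrow> L 0 (t, x)"
        by (intro AE_I2 continuous_on_tendsto_compose[OF L_cont(2) l_lim]) auto
      show "AE x in u t. norm (L (l k) (t, x)) \<le> W" for k
        using L_bound'[OF l] by simp
    qed (use meas in auto)
    have "\<bar>LINT x|u t. L (l k) (t, x)\<bar> \<le> (LINT x|u t. \<bar>L (l k) (t, x)\<bar>)"
      by (rule integral_abs_bound)
    also have "\<dots> \<le> (LINT x|u t. W * indicator {a..b} t)"
    proof (rule integral_mono)
      show "integrable (u t) (\<lambda>x. \<bar>L (l k) (t, x)\<bar>)"
        using L_bound'[OF l] meas by (intro integrable_const_bound[of _ W]) auto
      show "\<bar>L (l k) (t, x)\<bar> \<le> W * indicator {a..b} t" for x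
        by (rule L_bound[OF l])
    qed simp
    finally show "\<bar>LINT x|u t. L (l k) (t, x)\<bar> \<le> W * indicator {a..b} t"
      using prob_space by simp
  qed
  have "(\<lambda>k. LINT t|lborel. indicator {0<..} t *\<^sub>R (LINT x|u t. L (l k) (t, x)))
      \<longlonglongrightarrow> (LINT t|lborel. indicator {0<..} t *\<^sub>R (LINT x|u t. L 0 (t, x)))"
  proof (rule integral_dominated_convergence[where w = "\<lambda>t. W * indicator {a..b} t"])
    have cont: "continuous_on {0..} (\<lambda>t. LINT x|u t. L (l k) (t, x))" for k
      by (rule continuous_on_integral_W2_curve[OF u curve L_cont(1) L_bound'[OF l]])
    have "(\<lambda>t. indicator {0<..} t *\<^sub>R (LINT x|u t. L (l k) (t, x))) \<in> borel_measurable borel" for k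
      by (rule borel_measurable_continuous_on_indicator[OF _ continuous_on_subset[OF cont]]) auto
    then show meas: "(\<lambda>t. indicator {0<..} t *\<^sub>R (LINT x|u t. L (l k) (t, x))) \<in> borel_measurable lborel" for k
      by simp
    show "AE t in lborel. (\<lambda>k. indicator {0<..} t *\<^sub>R (LINT x|u t. L (l k) (t, x)))
        \<longlonglongrightarrow> indicator {0<..} t *\<^sub>R (LINT x|u t. L 0 (t, x))"
      using inner by (intro AE_I2) (auto simp: indicator_def)
    show "(\<lambda>t. indicator {0<..} t *\<^sub>R (LINT x|u t. L 0 (t, x))) \<in> borel_measurable lborel"
      by (rule borel_measurable_LIMSEQ_metric
          [where f = "\<lambda>k t. indicator {0<..} t *\<^sub>R (LINT x|u t. L (l k) (t, x))", OF meas])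
        (use inner in \<open>auto simp: indicator_def\<close>)
    show "AE t in lborel. norm (indicator {0<..} t *\<^sub>R (LINT x|u t. L (l k) (t, x))) \<le> W * indicator {a..b} t" for k
    proof (intro AE_I2)
      fix t :: real
      show "norm (indicator {0<..} t *\<^sub>R (LINT x|u t. L (l k) (t, x))) \<le> W * indicator {a..b} t"
        using inner_bound[of t k] W by (cases "t > 0") auto
    qed
    show "integrable lborel (\<lambda>t. W * indicator {a..b} t)"
      by (intro integrable_mult_right integrable_real_indicator) (auto simp: emeasure_lborel_Icc_eq)
  qed
  moreover have L0: "L 0 (t, x) = B 1 * \<kappa>' t * exp (exp (2 * t) * ((norm \<xi>)\<^sup>2 / 2))
      * cos (exp t * (\<xi> \<bullet> x) - \<theta>)" for t x
    by (simp add: L_def wave_adjoint_def Let_def)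
  ultimately have "(\<lambda>k. 0) \<longlonglongrightarrow> (LINT t|lborel. indicator {0<..} t *\<^sub>R (LINT x|u t. L 0 (t, x)))"
    using weak[OF l] by (simp add: set_lebesgue_integral_def)
  then have "0 = (LINT t|lborel. indicator {0<..} t *\<^sub>R (LINT x|u t. L 0 (t, x)))"
    by (rule LIMSEQ_unique[OF tendsto_const])
  also have "\<dots> = (LINT t|lborel. B 1 * (indicator {0<..} t *\<^sub>R (\<kappa>' t * (exp (exp (2 * t) * ((norm \<xi>)\<^sup>2 / 2))
    * (LINT x|u t. cos (exp t * (\<xi> \<bullet> x) - \<theta>))))))"
    by (intro Bochner_Integration.integral_cong refl)
      (simp only: L0 integral_mult_right_zero, simp add: mult_ac)
  finally show ?thesis
    using B1 by (simp add: set_lebesgue_integral_def)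
qed

lemma charfun_cos_sin:
  fixes \<mu> :: "'a::euclidean_space measure"
  assumes "prob_space \<mu>" and [measurable_cong]: "sets \<mu> = sets borel"
  shows "charfun \<mu> \<xi> = Complex (LINT x|\<mu>. cos (\<xi> \<bullet> x)) (LINT x|\<mu>. sin (\<xi> \<bullet> x))"
proof -
  interpret prob_space \<mu> by fact
  have "integrable \<mu> (\<lambda>x. iexp (\<xi> \<bullet> x))"
    by (rule integrable_const_bound[of _ 1]) (auto simp: norm_exp_i_times)
  then show ?thesis
    unfolding charfun_def
    by (simp add: complex_eq_iff Re_exp Im_exp flip: integral_Re integral_Im)
qed

text \<open>The value of the characteristic function of \<open>u t\<close> at \<open>\<eta>\<close> is carried along the characteristic
  \<open>e\<^sup>t \<xi>\<close> that passes through \<open>\<eta>\<close> at time \<open>t\<close>, that is, \<open>\<xi> = e\<^sup>-\<^sup>t \<eta>\<close>. This is the characteristic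
  function of the Ornstein-Uhlenbeck process at time \<open>t\<close>.\<close>

theorem charfun_fokker_planck_solution:
  fixes u :: "real \<Rightarrow> 'a::euclidean_space measure"
  assumes u: "\<And>t. t \<ge> 0 \<Longrightarrow> u t \<in> P2"
    and curve: "\<And>t. t \<ge> 0 \<Longrightarrow> ((\<lambda>s. W2 (u s) (u t)) \<longlongrightarrow> 0) (at t within {0..})"
    and FP: "fokker_planck_solution u" and t: "t \<ge> 0"
  shows "charfun (u t) \<eta> = charfun (u 0) (exp (- t) *\<^sub>R \<eta>)
    * of_real (exp (- (1 - exp (- 2 * t)) * (norm \<eta>)\<^sup>2 / 2))"
proof -
  define \<xi> where "\<xi> = exp (- t) *\<^sub>R \<eta>"
  have \<xi>: "exp t *\<^sub>R \<xi> = \<eta>" "(norm \<xi>)\<^sup>2 = exp (- 2 * t) * (norm \<eta>)\<^sup>2"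
    using exp_double[of "- t"] by (simp_all add: \<xi>_def exp_minus power_mult_distrib)
  define E where "E t = exp (exp (2 * t) * ((norm \<xi>)\<^sup>2 / 2))" for t
  \<comment> \<open>by the choice of \<open>E\<close> these functions of time are constant\<close>
  define g where "g \<theta> t = E t * (LINT x|u t. cos (exp t * (\<xi> \<bullet> x) - \<theta>))" for \<theta> t
  have g_const: "g \<theta> t = g \<theta> 0" for \<theta>
  proof (rule constant_if_weak_derivative_zero[OF _ _ t])
    have "continuous_on {0..} (\<lambda>t. LINT x|u t. (\<lambda>z. cos (exp (fst z) * (\<xi> \<bullet> snd z) - \<theta>)) (t, x))"
      by (rule continuous_on_integral_W2_curve[OF u curve, where M = 1])
        (auto intro!: continuous_intros)
    then show "continuous_on {0..} (g \<theta>)"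
      unfolding g_def E_def by (auto intro!: continuous_intros)
    show "(LINT t:{0<..}|lborel. \<kappa>' t * g \<theta> t) = 0"
      if "0 < a" "\<And>k. C_k k \<kappa>" "\<And>k. C_k k \<kappa>'" "\<And>t. (\<kappa> has_real_derivative \<kappa>' t) (at t)"
        "\<And>t. t \<notin> {a..b} \<Longrightarrow> \<kappa> t = 0" "\<And>t. t \<notin> {a..b} \<Longrightarrow> \<kappa>' t = 0" for \<kappa> \<kappa>' a b
      unfolding g_def E_def by (rule fokker_planck_wave_weak[OF u curve FP that])
  qed
  have cf: "of_real (E s) * charfun (u s) (exp s *\<^sub>R \<xi>) = Complex (g 0 s) (g (pi / 2) s)" if "s \<ge> 0" for s
    using P2_D[OF u[OF that]]
    by (simp add: charfun_cos_sin g_def complex_eq_iff cos_diff)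
  have "of_real (E t) * charfun (u t) \<eta> = of_real (E 0) * charfun (u 0) \<xi>"
    using cf[OF t] cf[of 0] g_const by (simp add: \<xi>(1))
  then have "charfun (u t) \<eta> = charfun (u 0) \<xi> * of_real (E 0 / E t)"
    by (simp add: E_def field_simps)
  also have "E 0 / E t = exp (- (1 - exp (- 2 * t)) * (norm \<eta>)\<^sup>2 / 2)"
  proof -
    have "exp (2 * t) * (exp (- 2 * t) * (norm \<eta>)\<^sup>2 / 2) = (norm \<eta>)\<^sup>2 / 2"
      by (simp add: exp_minus)
    then show ?thesis
      by (simp add: E_def \<xi>(2) exp_diff[symmetric] algebra_simps diff_divide_distrib)
  qed
  finally show ?thesis
    by (simp add: \<xi>_def)
qed

theorem corollary3p8:
  fixes u :: "real \<Rightarrow> (real ^ 'n) measure" and t :: real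
  assumes "u 0 \<in> P2"
    and "entropy_gradient_flow u"
    and "fokker_planck_solution u"
    and "(LINT x|u 0. (norm x)\<^sup>2) \<le> real CARD('n)"
    and "t \<ge> 0"
  shows "(W2 (u t) std_gaussian)\<^sup>2 \<le>
    (W2 (u 0) std_gaussian)\<^sup>2 * exp (- 2 * t) *
    ((1 - (W2 (u 0) std_gaussian)\<^sup>2 / (4 * real CARD('n))) /
     (1 - (W2 (u 0) std_gaussian)\<^sup>2 * exp (- 2 * t) / (4 * real CARD('n))))"
proof (cases "t = 0")
  case True
  have "(W2 (u 0) std_gaussian)\<^sup>2 \<le> real CARD('n) + real CARD('n)"
    using W2_gaussian_le[OF assms(1)] assms(4) by simp
  moreover have "real CARD('n) > 0" by simp
  ultimately have "(W2 (u 0) std_gaussian)\<^sup>2 < 4 * real CARD('n)" by linarith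
  then have "1 - (W2 (u 0) std_gaussian)\<^sup>2 / (4 * real CARD('n)) \<noteq> 0" by simp
  then show ?thesis
    using True by simp
next
  case False
  with \<open>t \<ge> 0\<close> have t: "t > 0" by simp
  have u: "\<And>t. t \<ge> 0 \<Longrightarrow> u t \<in> P2"
    and curve: "\<And>t. t \<ge> 0 \<Longrightarrow> ((\<lambda>s. W2 (u s) (u t)) \<longlongrightarrow> 0) (at t within {0..})"
    using assms(2) by (simp_all add: entropy_gradient_flow_def evi_gradient_flow_def)
  have sqrt: "sqrt (exp (- 2 * t)) = exp (- t)"
    by (rule real_sqrt_unique) (simp_all add: exp_double[symmetric])
  have "charfun (u t) \<xi> = charfun (u 0) (sqrt (exp (- 2 * t)) *\<^sub>R \<xi>)
      * of_real (exp (- (1 - exp (- 2 * t)) * (norm \<xi>)\<^sup>2 / 2))" for \<xi>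
    unfolding sqrt by (rule charfun_fokker_planck_solution[OF u curve assms(3,5)])
  from W2_gaussian_contraction[OF assms(1) P2_D(1,2)[OF u[OF assms(5)]] _ _ this] show ?thesis
    using t assms(4) by simp
qed

end
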